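(* Let $G$ be a connected simple graph, finite or infinite, whose maximum degree $\Delta$ is finite and whose minimum degree is $\delta$. If $\delta \geq \Delta/2$ and $G \neq K_2$, then $G$ admits an asymmetric edge-coloring with three colors; that is, there is a map $\phi: E(G) \to \{1,2,3\}$ such that the only automorphism $\sigma$ of $G$ satisfying $\phi(\sigma(x)\sigma(y)) = \phi(xy)$ for all edges $xy \in E(G)$ is the identity.
   Context: An edge-coloring $\phi: E(G)\to\{1,\dots,r\}$ is an arbitrary function (adjacent edges may receive the same color). It is called asymmetric if no nontrivial automorphism of $G$ preserves the colors of the edges. *)

theory Defs
  imports Complex_Main "HOL-Library.Extended_Nat" "HOL-Library.Ramsey"
begin

text \<open>
  A graph is given by a set \<open>V\<close> of vertices and a set \<open>E\<close> of edges, an edge being a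
  two-element set of vertices. Both sets may be infinite.
\<close>

definition simple_graph :: "'a set \<Rightarrow> 'a set set \<Rightarrow> bool" where
  "simple_graph V E \<longleftrightarrow> E \<subseteq> nsets V 2"

definition connected_graph :: "'a set \<Rightarrow> 'a set set \<Rightarrow> bool" where
  "connected_graph V E \<longleftrightarrow>
     V \<noteq> {} \<and> (\<forall>x\<in>V. \<forall>y\<in>V. (x, y) \<in> {(u, v). {u, v} \<in> E}\<^sup>*)"

text \<open>Complete graph on \<open>n\<close> vertices, up to isomorphism.\<close>

definition is_complete_graph :: "nat \<Rightarrow> 'a set \<Rightarrow> 'a set set \<Rightarrow> bool" where
  "is_complete_graph n V E \<longleftrightarrow> finite V \<and> card V = n \<and> E = nsets V 2"

definition neighbours :: "'a set set \<Rightarrow> 'a \<Rightarrow> 'a set" where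
  "neighbours E v = {u. {v, u} \<in> E}"

text \<open>
  Degrees are extended natural numbers, so that a vertex of infinite degree does not get
  degree \<open>0\<close> from \<^const>\<open>card\<close>. Over a nonempty vertex set the infimum is attained, and so is
  the supremum if it is finite; the supremum is \<open>\<infinity>\<close> if the degrees are unbounded.
\<close>

definition degree :: "'a set set \<Rightarrow> 'a \<Rightarrow> enat" where
  "degree E v = (if finite (neighbours E v) then enat (card (neighbours E v)) else \<infinity>)"

definition max_degree :: "'a set \<Rightarrow> 'a set set \<Rightarrow> enat" where
  "max_degree V E = (SUP v\<in>V. degree E v)"

definition min_degree :: "'a set \<Rightarrow> 'a set set \<Rightarrow> enat" where
  "min_degree V E = (INF v\<in>V. degree E v)"

definition graph_automorphism :: "'a set \<Rightarrow> 'a set set \<Rightarrow> ('a \<Rightarrow> 'a) \<Rightarrow> bool" where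
  "graph_automorphism V E \<sigma> \<longleftrightarrow>
     bij_betw \<sigma> V V \<and> (\<forall>x\<in>V. \<forall>y\<in>V. {\<sigma> x, \<sigma> y} \<in> E \<longleftrightarrow> {x, y} \<in> E)"

definition preserves_edge_colours ::
    "'a set set \<Rightarrow> ('a set \<Rightarrow> 'c) \<Rightarrow> ('a \<Rightarrow> 'a) \<Rightarrow> bool" where
  "preserves_edge_colours E \<phi> \<sigma> \<longleftrightarrow> (\<forall>x y. {x, y} \<in> E \<longrightarrow> \<phi> {\<sigma> x, \<sigma> y} = \<phi> {x, y})"

text \<open>
  Automorphisms are total functions of which only the restriction to \<open>V\<close> matters; hence
  being the identity is also required on \<open>V\<close> only.
\<close>

definition asymmetric_edge_colouring ::
    "'a set \<Rightarrow> 'a set set \<Rightarrow> ('a set \<Rightarrow> 'c) \<Rightarrow> bool" where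
  "asymmetric_edge_colouring V E \<phi> \<longleftrightarrow>
     (\<forall>\<sigma>. graph_automorphism V E \<sigma> \<and> preserves_edge_colours E \<phi> \<sigma> \<longrightarrow> (\<forall>x\<in>V. \<sigma> x = x))"

end

(*
Fix a root r and a normal spanning tree T: every edge joins a vertex to one of its ancestors.
Colour the edges so that a tree edge from v to its child y has a larger colour than every other
edge from v into the subtree of y; then a colour-preserving automorphism fixing r is an
automorphism of T, and it remains to separate siblings.

Finite subtrees: give every vertex a label modulo delta. A leaf has delta - 1 or more non-tree
edges to ancestors and encodes its label as the number of those coloured 1; an inner vertex has as
label the sum of the labels of the children whose edge is not coloured 1. The edge from v to y may
be coloured 1 only if it is the sole edge from v into the subtree of y. As v has at most
Delta - 1 <= 2 delta - 1 children, at most delta - 1 of which have further edges from v into their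
subtree, the children split into two classes of sizes at most delta - 1 (at most 1 if delta = 1) and
delta, inside which labels are distinct. A set of 1 <= n < delta distinct residues can have any prescribed sum.

Infinite subtrees: each contains vertices of arbitrarily large depth where the colouring can be
modified locally. Modify it at a set of such vertices with pairwise distinct depths that meets
every infinite subtree: these vertices, hence their ancestors, are fixed.

Root: if some normal spanning tree has a leaf, take that leaf as r and let T start with the path
through all its neighbours. Colouring the first edge 3 and the other edges at r with 1 costs
nothing, since these neighbours are already recognised by the position of their subtrees. If no
normal spanning tree has a leaf, then all subtrees are infinite.
*)
theory Submission
  imports Defs "HOL-Library.Countable_Set"
begin

section \<open>Distinct residues with prescribed sum\<close>

lemma ex_set_sum_mod:
  fixes d n t :: nat
  assumes "1 \<le> n" "n < d"
  shows "\<exists>A\<subseteq>{..<d}. card A = n \<and> (\<Sum>A) mod d = t mod d"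
proof -
  \<comment> \<open>Some \<open>b\<close> in \<open>A\<close> has its cyclic successor outside \<open>A\<close>; replacing \<open>b\<close> by it raises the sum by 1.\<close>
  have step: "\<exists>B\<subseteq>{..<d}. card B = n \<and> (\<Sum>B) mod d = Suc (\<Sum>A) mod d"
    if A: "A \<subseteq> {..<d}" "card A = n" for A
  proof -
    have finA: "finite A" using A(1) finite_subset by blast
    have "\<exists>b\<in>A. Suc b mod d \<notin> A"
    proof (rule ccontr)
      assume H: "\<not> ?thesis"
      obtain a where a: "a \<in> A" using A assms by fastforce
      \<comment> \<open>Closure under the cyclic successor forces \<open>A\<close> to be all of
        \<open>{..<d}\<close>, against \<open>n < d\<close>.\<close>
      have "(a + k) mod d \<in> A" for k
      proof (induction k)
        case 0
        then show ?case using a A by auto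
      next
        case (Suc k)
        then have "Suc ((a + k) mod d) mod d \<in> A" using H by blast
        then show ?case by (simp add: mod_Suc_eq)
      qed
      moreover have "(a + (x + (d - a))) mod d = x" if "x < d" for x
        using that a A(1) by auto
      ultimately have "{..<d} \<subseteq> A" by (metis lessThan_iff subsetI)
      then show False using A assms
        by (metis card_lessThan finite_lessThan card_mono finA not_le)
    qed
    then obtain b where b: "b \<in> A" "Suc b mod d \<notin> A" by blast
    let ?B = "insert (Suc b mod d) (A - {b})"
    have "?B \<subseteq> {..<d}" using A(1) assms by auto
    moreover have "card ?B = n" using b finA A assms by simp
    moreover have "(\<Sum>?B) mod d = Suc (\<Sum>A) mod d"
    proof -
      have "\<Sum>?B = Suc b mod d + \<Sum>(A - {b})" using b finA by simp
      moreover have "\<Sum>A = b + \<Sum>(A - {b})" using b finA by (simp add: sum.remove)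
      ultimately show ?thesis by (metis add_Suc mod_add_left_eq)
    qed
    ultimately show ?thesis by blast
  qed
  have all: "\<exists>A\<subseteq>{..<d}. card A = n \<and> (\<Sum>A) mod d = (\<Sum>{..<n} + k) mod d" for k
  proof (induction k)
    case 0
    show ?case using assms by (intro exI[of _ "{..<n}"]) auto
  next
    case (Suc k)
    then obtain A where A: "A \<subseteq> {..<d}" "card A = n" "(\<Sum>A) mod d = (\<Sum>{..<n} + k) mod d"
      by blast
    obtain B where "B \<subseteq> {..<d}" "card B = n" "(\<Sum>B) mod d = Suc (\<Sum>A) mod d"
      using step[OF A(1,2)] by blast
    moreover have "Suc (\<Sum>A) mod d = (\<Sum>{..<n} + Suc k) mod d"
      using A(3) by (metis add_Suc_right mod_Suc_eq)
    ultimately show ?case by metis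
  qed
  \<comment> \<open>The number of unit steps: first up to a multiple of \<open>d\<close>, then
    \<open>t\<close> more.\<close>
  have "(\<Sum>{..<n} + (t + (d - \<Sum>{..<n} mod d))) mod d = t mod d"
  proof -
    define s where "s = \<Sum>{..<n}"
    have "s mod d \<le> d" using assms by (simp add: order_less_imp_le)
    then have "s + (t + (d - s mod d)) = t + d * (s div d + 1)"
      using mult_div_mod_eq[of d s] by (simp only: distrib_left)
    then show ?thesis unfolding s_def[symmetric] by (simp only: mod_mult_self2)
  qed
  then show ?thesis using all[of "t + (d - \<Sum>{..<n} mod d)"] by metis
qed

text \<open>Used to give siblings distinct labels with a prescribed sum. The alternative
  \<open>d = 1\<close> serves the case \<delta> = 1, where all sums are congruent and a single child
  can carry the label 0.\<close>

lemma ex_inj_sum_mod: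
  fixes d t :: nat and S :: "'a set"
  assumes "finite S" "S \<noteq> {}" "card S < d \<or> d = 1 \<and> card S = 1"
  shows "\<exists>f. inj_on f S \<and> f ` S \<subseteq> {..<d} \<and> sum f S mod d = t mod d"
proof (cases "card S < d")
  case True
  have "1 \<le> card S" using assms by (simp add: Suc_leI card_gt_0_iff)
  then obtain A where A: "A \<subseteq> {..<d}" "card A = card S" "(\<Sum>A) mod d = t mod d"
    using ex_set_sum_mod[OF _ True] by blast
  have "finite A" using A(1) finite_subset by blast
  then obtain f where f: "bij_betw f S A" using A(2) assms(1) by (metis finite_same_card_bij)
  have "sum f S = \<Sum>A" using sum.reindex_bij_betw[OF f, of "\<lambda>x. x"] by simp
  then show ?thesis using f A by (intro exI[of _ f]) (auto simp: bij_betw_def)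
next
  case False
  then have "d = 1" "card S = 1" using assms(3) by auto
  then obtain a where "S = {a}" by (metis card_1_singletonE)
  then show ?thesis using \<open>d = 1\<close> by (intro exI[of _ "\<lambda>_. 0"]) auto
qed

section \<open>Normal spanning trees of countable graphs\<close>

text \<open>A rooted tree is encoded by ancestors: \<open>X n t\<close> is the ancestor of
  \<open>t\<close> at depth \<open>n\<close>, unspecified for \<open>n > dep t\<close>. The last
  assumption is normality: it makes the ends of every edge comparable.\<close>

locale normal_tree =
  fixes V :: "'a set" and E :: "'a set set" and r :: 'a
    and X :: "nat \<Rightarrow> 'a \<Rightarrow> 'a" and dep :: "'a \<Rightarrow> nat"
  assumes edge_V: "{x, y} \<in> E \<Longrightarrow> x \<in> V \<and> y \<in> V \<and> x \<noteq> y"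
    and fin_nb: "finite {y. {x, y} \<in> E}"
    and root_V: "r \<in> V"
    and X_0: "t \<in> V \<Longrightarrow> X 0 t = r"
    and X_dep: "t \<in> V \<Longrightarrow> X (dep t) t = t"
    and X_V: "t \<in> V \<Longrightarrow> n \<le> dep t \<Longrightarrow> X n t \<in> V"
    and dep_X: "t \<in> V \<Longrightarrow> n \<le> dep t \<Longrightarrow> dep (X n t) = n"
    and X_X: "t \<in> V \<Longrightarrow> m \<le> n \<Longrightarrow> n \<le> dep t \<Longrightarrow> X m (X n t) = X m t"
    and X_edge: "t \<in> V \<Longrightarrow> n < dep t \<Longrightarrow> {X n t, X (Suc n) t} \<in> E"
    and edge_comparable: "{u, w} \<in> E \<Longrightarrow> dep u \<le> dep w \<Longrightarrow> X (dep u) w = u"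

section \<open>Components of induced subgraphs\<close>

definition induced_rel :: "'a set set \<Rightarrow> 'a set \<Rightarrow> ('a \<times> 'a) set" where
  "induced_rel E S = {(a, b). {a, b} \<in> E \<and> a \<in> S \<and> b \<in> S}"

definition component :: "'a set set \<Rightarrow> 'a set \<Rightarrow> 'a \<Rightarrow> 'a set" where
  "component E S t = {y. (t, y) \<in> (induced_rel E S)\<^sup>*}"

lemma induced_rel_sym: "sym (induced_rel E S)"
  by (auto simp: sym_def induced_rel_def insert_commute)

lemma self_in_component: "t \<in> component E S t"
  by (simp add: component_def)

lemma component_subset: "t \<in> S \<Longrightarrow> component E S t \<subseteq> S"
proof -
  assume t: "t \<in> S"
  have "(t, y) \<in> (induced_rel E S)\<^sup>* \<Longrightarrow> y \<in> S" for y
    by (induction rule: rtrancl_induct) (auto simp: t induced_rel_def)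
  then show ?thesis by (auto simp: component_def)
qed

lemma component_eqI: "u \<in> component E S t \<Longrightarrow> component E S u = component E S t"
  unfolding component_def
  by (auto intro: rtrancl_trans dest: symD[OF sym_rtrancl[OF induced_rel_sym]])

lemma component_step:
  "u \<in> component E S t \<Longrightarrow> {u, w} \<in> E \<Longrightarrow> u \<in> S \<Longrightarrow> w \<in> S \<Longrightarrow> w \<in> component E S t"
  unfolding component_def by (auto intro: rtrancl_into_rtrancl simp: induced_rel_def)

lemma component_connected:
  assumes "t \<in> S"
  shows "component E (component E S t) t = component E S t"
proof -
  have "(t, y) \<in> (induced_rel E (component E S t))\<^sup>*" if "(t, y) \<in> (induced_rel E S)\<^sup>*" for y
    using that
  proof (induction rule: rtrancl_induct)
    case (step y z)
    then have "y \<in> component E S t" "z \<in> component E S t"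
      by (auto simp: component_def)
    then have "(y, z) \<in> induced_rel E (component E S t)"
      using step.hyps(2) by (simp add: induced_rel_def)
    then show ?case using step.IH by (rule rtrancl_into_rtrancl[rotated])
  qed simp
  moreover have "component E (component E S t) t \<subseteq> component E S t"
    by (rule component_subset[OF self_in_component])
  ultimately show ?thesis by (auto simp: component_def)
qed

text \<open>A walk from \<open>t\<close> to \<open>x\<close> inside \<open>D\<close> stays in the
  component of \<open>t\<close> until it first meets \<open>x\<close>, so the vertex just before
  lies in that component. Hence the search always finds a neighbour of the current vertex to move
  to.\<close>

lemma component_delete_adjacent:
  assumes "component E D t = D" "x \<in> D" "t \<noteq> x"
  shows "\<exists>y\<in>component E (D - {x}) t. {x, y} \<in> E"
proof -
  let ?C = "component E (D - {x}) t"
  have "t \<in> D" using assms(1) self_in_component by metis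
  then have sub: "?C \<subseteq> D - {x}" using assms(3) by (intro component_subset) auto
  have "y \<in> ?C \<or> (\<exists>u\<in>?C. {x, u} \<in> E)" if "(t, y) \<in> (induced_rel E D)\<^sup>*" for y
    using that
  proof (induction rule: rtrancl_induct)
    case base
    then show ?case by (simp add: self_in_component)
  next
    case (step y z)
    show ?case
    proof (cases "y \<in> ?C \<and> \<not> (\<exists>u\<in>?C. {x, u} \<in> E)")
      case True
      have e: "{y, z} \<in> E" "y \<in> D" "z \<in> D" using step by (auto simp: induced_rel_def)
      have "z \<noteq> x" using True e by (auto simp: insert_commute)
      moreover have "y \<noteq> x" using True sub by auto
      ultimately show ?thesis using component_step[of y E "D - {x}" t z] True e by auto
    qed (use step in blast)
  qed
  moreover have "(t, x) \<in> (induced_rel E D)\<^sup>*" using assms by (auto simp: component_def)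
  moreover have "x \<notin> ?C" using sub by auto
  ultimately show ?thesis by blast
qed

text \<open>
  The normal tree starts with the path \<open>c\<close>. The state of \<open>t\<close> after \<open>n\<close> steps is its ancestor at
  depth \<open>n\<close> with the component of \<open>t\<close> left by the earlier ancestors; it is meaningless once \<open>t\<close>
  itself has been reached. Always moving towards the vertex of least index in the component makes
  the search exhaust an infinite graph.
\<close>

locale tree_search =
  fixes V :: "'a set" and E :: "'a set set" and idx :: "'a \<Rightarrow> nat"
    and c :: "nat \<Rightarrow> 'a" and z :: nat
  assumes edge_V: "{x, y} \<in> E \<Longrightarrow> x \<in> V \<and> y \<in> V \<and> x \<noteq> y"
    and connected: "t \<in> V \<Longrightarrow> component E V t = V"
    and idx_inj: "inj_on idx V"
    and fin_nb: "finite {y. {x, y} \<in> E}"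
    and c_V: "i \<le> z \<Longrightarrow> c i \<in> V"
    and c_inj: "inj_on c {..z}"
    and c_edge: "i < z \<Longrightarrow> {c i, c (Suc i)} \<in> E"
begin

definition target :: "'a set \<Rightarrow> 'a" where
  "target D = (ARG_MIN idx m. m \<in> D)"

text \<open>The distance to the target inside the subgraph induced by \<open>D\<close>.\<close>

definition to_target :: "'a set \<Rightarrow> 'a \<Rightarrow> nat" where
  "to_target D y = (LEAST k. (y, target D) \<in> induced_rel E D ^^ k)"

definition nearest :: "'a \<Rightarrow> 'a set \<Rightarrow> 'a" where
  "nearest x D = (ARG_MIN (to_target D) y. y \<in> D \<and> {x, y} \<in> E)"

primrec state :: "nat \<Rightarrow> 'a \<Rightarrow> 'a \<times> 'a set" where
  "state 0 t = (c 0, V)"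
| "state (Suc n) t =
    (let x = fst (state n t); D = component E (snd (state n t) - {x}) t
     in (if n < z \<and> x = c n \<and> c (Suc n) \<in> D then c (Suc n) else nearest x D, D))"

abbreviation X :: "nat \<Rightarrow> 'a \<Rightarrow> 'a" where "X n t \<equiv> fst (state n t)"
abbreviation D :: "nat \<Rightarrow> 'a \<Rightarrow> 'a set" where "D n t \<equiv> snd (state n t)"

lemma D_Suc: "D (Suc n) t = component E (D n t - {X n t}) t"
  by (simp add: Let_def)

lemma X_Suc: "X (Suc n) t =
    (if n < z \<and> X n t = c n \<and> c (Suc n) \<in> D (Suc n) t then c (Suc n) else nearest (X n t) (D (Suc n) t))"
  by (auto simp: Let_def)

declare state.simps(2) [simp del]

lemma target_in: "S \<noteq> {} \<Longrightarrow> target S \<in> S"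
  unfolding target_def by (metis arg_min_natI ex_in_conv)

lemma target_le: "y \<in> S \<Longrightarrow> idx (target S) \<le> idx y"
  unfolding target_def by (rule arg_min_nat_le)

lemma nearest:
  assumes "y \<in> S" "{x, y} \<in> E"
  shows "nearest x S \<in> S" "{x, nearest x S} \<in> E" "to_target S (nearest x S) \<le> to_target S y"
  using arg_min_natI[of "\<lambda>y. y \<in> S \<and> {x, y} \<in> E" y "to_target S"]
    arg_min_nat_le[of "\<lambda>y. y \<in> S \<and> {x, y} \<in> E" y "to_target S"] assms
  unfolding nearest_def by blast+

text \<open>Induction on \<open>n\<close>: passing to the component of \<open>t\<close> keeps the
  set connected, and \<open>component_delete_adjacent\<close> supplies a candidate for
  \<open>nearest\<close>. The second hypothesis ensures that \<open>t\<close> survives the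
  deletions.\<close>

lemma state_invariant:
  assumes "t \<in> V" "\<forall>m<n. X m t \<noteq> t"
  shows "t \<in> D n t \<and> D n t \<subseteq> V \<and> X n t \<in> D n t \<and> component E (D n t) t = D n t"
    and "\<forall>m<n. X m t \<notin> D n t"
    and "\<forall>m<n. {X m t, X (Suc m) t} \<in> E"
proof -
  have "(t \<in> D n t \<and> D n t \<subseteq> V \<and> X n t \<in> D n t \<and> component E (D n t) t = D n t)
     \<and> (\<forall>m<n. X m t \<notin> D n t) \<and> (\<forall>m<n. {X m t, X (Suc m) t} \<in> E)"
    using assms(2)
  proof (induction n)
    case 0
    then show ?case using assms(1) connected c_V by simp
  next
    case (Suc n)
    then have IH: "t \<in> D n t" "D n t \<subseteq> V" "X n t \<in> D n t" "component E (D n t) t = D n t"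
      "\<forall>m<n. X m t \<notin> D n t" "\<forall>m<n. {X m t, X (Suc m) t} \<in> E"
      by auto
    have ne: "t \<noteq> X n t" using Suc.prems by (metis lessI)
    let ?S = "D n t - {X n t}"
    have tS: "t \<in> ?S" using IH(1) ne by simp
    have sub: "D (Suc n) t \<subseteq> ?S" unfolding D_Suc by (rule component_subset[OF tS])
    obtain y where y: "y \<in> D (Suc n) t" "{X n t, y} \<in> E"
      using component_delete_adjacent[OF IH(4,3) ne] unfolding D_Suc by blast
    have "X (Suc n) t \<in> D (Suc n) t \<and> {X n t, X (Suc n) t} \<in> E"
      using nearest[OF y] c_edge unfolding X_Suc by auto
    moreover have "t \<in> D (Suc n) t" unfolding D_Suc by (rule self_in_component)
    moreover have "component E (D (Suc n) t) t = D (Suc n) t"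
      unfolding D_Suc by (rule component_connected[OF tS])
    ultimately show ?case using IH sub by (auto simp: less_Suc_eq)
  qed
  then show "t \<in> D n t \<and> D n t \<subseteq> V \<and> X n t \<in> D n t \<and> component E (D n t) t = D n t"
    and "\<forall>m<n. X m t \<notin> D n t" and "\<forall>m<n. {X m t, X (Suc m) t} \<in> E" by auto
qed

text \<open>A step depends on \<open>t\<close> only through its component, so vertices still in a
  common component have had the same history.\<close>

lemma state_cong:
  assumes "t \<in> V" "\<forall>m<n. X m t \<noteq> t" "u \<in> D n t" "m \<le> n"
  shows "state m u = state m t"
  using assms(2-)
proof (induction n arbitrary: m)
  case 0
  then show ?case by simp
next
  case (Suc n)
  have inv: "t \<in> D n t" using state_invariant(1)[OF assms(1)] Suc.prems by auto
  have "t \<noteq> X n t" using Suc.prems by (metis lessI)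
  then have tS: "t \<in> D n t - {X n t}" using inv by simp
  then have uD: "u \<in> D n t" using Suc.prems(2) component_subset[OF tS] unfolding D_Suc by blast
  have IH: "m \<le> n \<Longrightarrow> state m u = state m t" for m
    using Suc.IH[OF _ uD] Suc.prems by simp
  have "D (Suc n) u = D (Suc n) t"
    using component_eqI Suc.prems(2) unfolding D_Suc IH[OF order_refl] by metis
  moreover have "X (Suc n) u = X (Suc n) t"
    unfolding X_Suc calculation IH[OF order_refl] ..
  ultimately have "state (Suc n) u = state (Suc n) t" by (simp add: prod_eq_iff)
  then show ?case using IH Suc.prems(3) le_Suc_eq by metis
qed

lemma to_target_path:
  assumes "component E S t = S" "y \<in> S"
  shows "(y, target S) \<in> induced_rel E S ^^ to_target S y"
proof -
  have "target S \<in> component E S y"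
    using assms component_eqI target_in by (metis empty_iff)
  then have "\<exists>k. (y, target S) \<in> induced_rel E S ^^ k"
    by (auto simp: component_def rtrancl_power)
  then show ?thesis unfolding to_target_def by (rule LeastI_ex)
qed

text \<open>Let \<open>p\<close> follow \<open>y\<close> on a shortest path to the target. The rest
  of that path avoids \<open>y\<close>, so it survives in \<open>C\<close> and bounds the new
  distance of \<open>p\<close>, hence that of the neighbour chosen by
  \<open>nearest\<close>.\<close>

lemma to_target_decreases:
  assumes S: "component E S t = S" and y: "y \<in> S" and t: "t \<in> S - {y}"
    and C: "C = component E (S - {y}) t" and same: "target C = target S"
  shows "to_target C (nearest y C) < to_target S y"
proof -
  let ?m = "target S" and ?R = "induced_rel E S"
  have tC: "t \<in> C" unfolding C by (rule self_in_component)
  have CS: "C \<subseteq> S - {y}" unfolding C by (rule component_subset[OF t])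
  have mC: "?m \<in> C" using target_in[of C] same tC by auto
  have Ceq: "component E (S - {y}) ?m = C" using component_eqI mC unfolding C by metis
  define k where "k = to_target S y"
  have k: "(y, ?m) \<in> ?R ^^ k" using to_target_path[OF S y] k_def by simp
  have kmin: "k \<le> j" if "(y, ?m) \<in> ?R ^^ j" for j
    unfolding k_def to_target_def using that by (rule Least_le)
  have "k \<noteq> 0" using k mC CS by (cases k) auto
  then obtain k' where k': "k = Suc k'" by (cases k) auto
  then obtain p where p: "(y, p) \<in> ?R" "(p, ?m) \<in> ?R ^^ k'"
    using k by (metis relpow_Suc_D2)
  have path: "(a, ?m) \<in> induced_rel E C ^^ j \<and> a \<in> C" if "(a, ?m) \<in> ?R ^^ j" "j \<le> k'" for a j
    using that
  proof (induction j arbitrary: a)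
    case 0
    then show ?case using mC by simp
  next
    case (Suc j)
    then obtain b where b: "(a, b) \<in> ?R" "(b, ?m) \<in> ?R ^^ j" by (metis relpow_Suc_D2)
    have IH: "(b, ?m) \<in> induced_rel E C ^^ j" "b \<in> C" using Suc.IH[OF b(2)] Suc.prems by auto
    have "a \<noteq> y" using kmin[of "Suc j"] Suc.prems k' by auto
    then have "a \<in> C"
      using component_step[of b E "S - {y}" t a] IH(2) b(1) CS
      unfolding C by (auto simp: induced_rel_def insert_commute)
    moreover from this have "(a, b) \<in> induced_rel E C"
      using IH(2) b(1) by (auto simp: induced_rel_def)
    ultimately show ?case using IH(1) by (metis relpow_Suc_I2)
  qed
  have pC: "p \<in> C" "(p, target C) \<in> induced_rel E C ^^ k'"
    using path[OF p(2)] same by auto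
  have "to_target C p \<le> k'" unfolding to_target_def using pC(2) by (rule Least_le)
  moreover have "to_target C (nearest y C) \<le> to_target C p"
    using nearest(3)[OF pC(1)] p(1) by (simp add: induced_rel_def)
  ultimately show ?thesis using k' k_def by simp
qed

text \<open>The index of the target never drops and is bounded by \<open>idx t\<close>; while the
  target stays the same, its distance from the current vertex drops. An endless search would descend
  forever in the lexicographic order.\<close>

lemma reached:
  assumes t: "t \<in> V"
  shows "\<exists>n. X n t = t"
proof (rule ccontr)
  assume "\<not> ?thesis"
  then have nr: "\<forall>m<n. X m t \<noteq> t" for n by blast
  note inv = state_invariant[OF t nr]
  \<comment> \<open>The shift by \<open>z\<close> skips the steps governed by the prescribed path,
    so that all steps considered use \<open>nearest\<close>.\<close>
  define f where "f n = (idx t - idx (target (D (z + Suc n) t)),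
                         to_target (D (z + Suc n) t) (X (z + Suc n) t))" for n
  have "(f (Suc n), f n) \<in> less_than <*lex*> less_than" for n
  proof -
    let ?a = "z + Suc n"
    let ?S = "D ?a t" and ?C = "D (Suc ?a) t"
    have ne: "t \<in> ?S - {X ?a t}" using inv(1)[of ?a] nr[of "Suc ?a"] by auto
    have C: "?C = component E (?S - {X ?a t}) t" by (rule D_Suc)
    have sub: "?C \<subseteq> ?S" using component_subset[OF ne] unfolding C by blast
    have tC: "t \<in> ?C" using inv(1) by blast
    have le: "idx (target ?S) \<le> idx (target ?C)"
      using target_in[of ?C] tC sub by (intro target_le) auto
    have le2: "idx (target ?C) \<le> idx t" using target_le[OF tC] .
    show ?thesis
    proof (cases "target ?C = target ?S")
      case True
      have "X (Suc ?a) t = nearest (X ?a t) ?C" unfolding X_Suc by simp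
      then have "to_target ?C (X (Suc ?a) t) < to_target ?S (X ?a t)"
        using to_target_decreases[OF _ _ ne C True] inv(1)[of ?a] by simp
      then show ?thesis using True by (simp add: f_def)
    next
      case False
      have "target ?S \<in> V" "target ?C \<in> V"
        using inv(1)[of ?a] inv(1)[of "Suc ?a"] target_in[of ?S] target_in[of ?C] by auto
      then have "idx (target ?S) < idx (target ?C)"
        using False le idx_inj by (metis inj_on_eq_iff le_neq_implies_less)
      then have "idx t - idx (target ?C) < idx t - idx (target ?S)" using le2 by linarith
      then show ?thesis by (simp add: f_def)
    qed
  qed
  then show False
    using wf_lex_prod[OF wf_less_than wf_less_than] unfolding wf_iff_no_infinite_down_chain by metis
qed

definition depth :: "'a \<Rightarrow> nat" where
  "depth t = (LEAST n. X n t = t)"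

lemma X_depth: "t \<in> V \<Longrightarrow> X (depth t) t = t"
  unfolding depth_def by (rule LeastI_ex[OF reached])

lemma before_depth: "n \<le> depth t \<Longrightarrow> \<forall>m<n. X m t \<noteq> t"
  unfolding depth_def using not_less_Least[of _ "\<lambda>n. X n t = t"] by (meson order_less_le_trans)

lemma state_X:
  assumes "t \<in> V" "n \<le> depth t" "m \<le> n"
  shows "state m (X n t) = state m t"
  using state_cong[OF assms(1) before_depth[OF assms(2)] _ assms(3)]
    state_invariant(1)[OF assms(1) before_depth[OF assms(2)]] by blast

lemma depth_X:
  assumes "t \<in> V" "n \<le> depth t"
  shows "depth (X n t) = n"
  unfolding depth_def
proof (rule Least_equality)
  show "X n (X n t) = X n t" using state_X[OF assms order_refl] by simp
  fix m assume "X m (X n t) = X n t"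
  then have "m \<le> n \<Longrightarrow> X m t = X n t" using state_X[OF assms, of m] by simp
  then have "\<not> m < n"
    using state_invariant(1,2)[OF assms(1) before_depth[OF assms(2)]] by auto
  then show "n \<le> m" by simp
qed

text \<open>As long as neither end of an edge is deleted, the edge keeps both ends in one component,
  so their states agree up to the smaller depth.\<close>

lemma comparable:
  assumes "{u, w} \<in> E" "depth u \<le> depth w"
  shows "X (depth u) w = u"
proof -
  have V: "u \<in> V" "w \<in> V" using edge_V[OF assms(1)] by auto
  have "m \<le> depth u \<Longrightarrow> state m u = state m w" for m
  proof (induction m)
    case (Suc m)
    let ?S = "D m u - {X m u}"
    have eq: "state m u = state m w" using Suc by simp
    have bu: "\<forall>k<Suc m. X k u \<noteq> u" and bw: "\<forall>k<Suc m. X k w \<noteq> w"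
      using before_depth Suc.prems assms(2) order_trans by blast+
    have S: "u \<in> ?S" "w \<in> ?S"
      using state_invariant(1)[OF V(1), of m] state_invariant(1)[OF V(2), of m] bu bw eq
      by (auto simp: less_Suc_eq)
    have "w \<in> component E ?S u"
      by (rule component_step[OF self_in_component assms(1) S])
    then have "D (Suc m) u = D (Suc m) w"
      using component_eqI[of w E ?S u] unfolding D_Suc eq[symmetric] by simp
    moreover from this have "X (Suc m) u = X (Suc m) w" unfolding X_Suc eq by simp
    ultimately show ?case by (simp add: prod_eq_iff)
  qed simp
  then show ?thesis using X_depth[OF V(1)] by (metis order_refl)
qed

lemma normal_tree: "normal_tree V E (c 0) X depth"
proof
  show "x \<in> V \<and> y \<in> V \<and> x \<noteq> y" if "{x, y} \<in> E" for x y using edge_V that .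
  show "finite {y. {x, y} \<in> E}" for x by (rule fin_nb)
  show "c 0 \<in> V" by (rule c_V) simp
  fix t assume t: "t \<in> V"
  show "X 0 t = c 0" by simp
  show "X (depth t) t = t" using X_depth[OF t] .
  show "{X n t, X (Suc n) t} \<in> E" if "n < depth t" for n
    using state_invariant(3)[OF t before_depth[OF order_refl]] that by blast
  fix n assume n: "n \<le> depth t"
  show "X n t \<in> V" using state_invariant(1)[OF t before_depth[OF n]] by blast
  show "depth (X n t) = n" using depth_X[OF t n] .
  show "X m (X n t) = X m t" if "m \<le> n" for m using state_X[OF t n that] by simp
qed (rule comparable)

text \<open>While the first vertices of \<open>c\<close> are deleted, the remaining stretch of
  \<open>c\<close> stays connected, hence lies in one component, and the search follows it.\<close>

lemma path_start:
  assumes "i \<le> j" "j \<le> z"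
  shows "X i (c j) = c i"
proof -
  have "i \<le> j \<Longrightarrow> (\<forall>k\<in>{i..z}. c k \<in> D i (c j)) \<and> X i (c j) = c i" for i
  proof (induction i)
    case 0
    then show ?case using c_V by simp
  next
    case (Suc i)
    then have IH: "\<forall>k\<in>{i..z}. c k \<in> D i (c j)" "X i (c j) = c i" by auto
    let ?S = "D i (c j) - {c i}"
    have S: "c k \<in> ?S" if "Suc i \<le> k" "k \<le> z" for k
      using IH(1) that inj_onD[OF c_inj, of k i] by auto
    have "Suc i \<le> k \<Longrightarrow> k \<le> z \<Longrightarrow> c k \<in> component E ?S (c (Suc i))" for k
    proof (induction k rule: dec_induct)
      case base
      show ?case by (rule self_in_component)
    next
      case (step k)
      then show ?case using component_step[of "c k" E ?S _ "c (Suc k)"] S c_edge by simp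
    qed
    moreover have "component E ?S (c (Suc i)) = component E ?S (c j)"
      using calculation[of j] Suc.prems assms by (metis component_eqI)
    ultimately have all: "\<forall>k\<in>{Suc i..z}. c k \<in> D (Suc i) (c j)"
      unfolding D_Suc IH(2) by auto
    moreover have "Suc i \<le> z" using Suc.prems assms by simp
    ultimately show ?case unfolding X_Suc using IH(2) by simp
  qed
  then show ?thesis using assms by simp
qed

lemma depth_path:
  assumes "j \<le> z"
  shows "depth (c j) = j"
proof -
  have "X j (c j) = c j" using path_start[OF order_refl assms] .
  moreover have "X i (c j) \<noteq> c j" if "i < j" for i
    using path_start[of i j] that assms c_inj by (auto simp: inj_on_def)
  ultimately show ?thesis unfolding depth_def
    by (intro Least_equality) (auto simp: not_less[symmetric])
qed

end

section \<open>Automorphisms and normal trees\<close>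

definition colour_aut :: "'a set \<Rightarrow> 'a set set \<Rightarrow> ('a set \<Rightarrow> 'c) \<Rightarrow> ('a \<Rightarrow> 'a) \<Rightarrow> bool" where
  "colour_aut V E \<phi> \<sigma> \<longleftrightarrow> graph_automorphism V E \<sigma> \<and> preserves_edge_colours E \<phi> \<sigma>"

lemma colour_aut_bij: "colour_aut V E \<phi> \<sigma> \<Longrightarrow> bij_betw \<sigma> V V"
  by (simp add: colour_aut_def graph_automorphism_def)

lemma colour_aut_V: "colour_aut V E \<phi> \<sigma> \<Longrightarrow> x \<in> V \<Longrightarrow> \<sigma> x \<in> V"
  using colour_aut_bij bij_betwE by blast

lemma colour_aut_inj: "colour_aut V E \<phi> \<sigma> \<Longrightarrow> x \<in> V \<Longrightarrow> y \<in> V \<Longrightarrow> \<sigma> x = \<sigma> y \<longleftrightarrow> x = y"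
  using colour_aut_bij by (metis bij_betw_imp_inj_on inj_on_eq_iff)

lemma colour_aut_edge:
  "colour_aut V E \<phi> \<sigma> \<Longrightarrow> x \<in> V \<Longrightarrow> y \<in> V \<Longrightarrow> {\<sigma> x, \<sigma> y} \<in> E \<longleftrightarrow> {x, y} \<in> E"
  by (simp add: colour_aut_def graph_automorphism_def)

lemma colour_aut_colour:
  "colour_aut V E \<phi> \<sigma> \<Longrightarrow> {x, y} \<in> E \<Longrightarrow> \<phi> {\<sigma> x, \<sigma> y} = \<phi> {x, y}"
  by (simp add: colour_aut_def preserves_edge_colours_def)

lemma colour_aut_surj: "colour_aut V E \<phi> \<sigma> \<Longrightarrow> y \<in> V \<Longrightarrow> \<exists>x\<in>V. \<sigma> x = y"
  using colour_aut_bij by (metis bij_betw_imp_surj_on imageE)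

lemma colour_aut_inv_into:
  assumes \<sigma>: "colour_aut V E \<phi> \<sigma>" and E: "\<forall>x y. {x, y} \<in> E \<longrightarrow> x \<in> V \<and> y \<in> V"
  shows "colour_aut V E \<phi> (inv_into V \<sigma>)"
    and "x \<in> V \<Longrightarrow> \<sigma> (inv_into V \<sigma> x) = x" and "x \<in> V \<Longrightarrow> inv_into V \<sigma> (\<sigma> x) = x"
proof -
  let ?\<tau> = "inv_into V \<sigma>"
  note bij = colour_aut_bij[OF \<sigma>]
  have right: "\<sigma> (?\<tau> x) = x" if "x \<in> V" for x using bij_betw_inv_into_right[OF bij that] .
  have left: "?\<tau> (\<sigma> x) = x" if "x \<in> V" for x using bij_betw_inv_into_left[OF bij that] .
  have bij': "bij_betw ?\<tau> V V" by (rule bij_betw_inv_into[OF bij])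
  have \<tau>V: "?\<tau> x \<in> V" if "x \<in> V" for x using bij' that by (rule bij_betwE[rule_format])
  have edge: "{?\<tau> x, ?\<tau> y} \<in> E \<longleftrightarrow> {x, y} \<in> E" if "x \<in> V" "y \<in> V" for x y
    using colour_aut_edge[OF \<sigma> \<tau>V[OF that(1)] \<tau>V[OF that(2)]] right that by simp
  have "\<phi> {?\<tau> x, ?\<tau> y} = \<phi> {x, y}" if "{x, y} \<in> E" for x y
    using colour_aut_colour[OF \<sigma>, of "?\<tau> x" "?\<tau> y"] edge right E that by metis
  then show "colour_aut V E \<phi> ?\<tau>"
    using bij' edge by (simp add: colour_aut_def graph_automorphism_def preserves_edge_colours_def)
  show "x \<in> V \<Longrightarrow> \<sigma> (?\<tau> x) = x" by (rule right)
  show "x \<in> V \<Longrightarrow> ?\<tau> (\<sigma> x) = x" by (rule left)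
qed

section \<open>Parents, subtrees and children in a normal tree\<close>

context normal_tree
begin

text \<open>Truncated subtraction makes \<open>par r = r\<close>; the depth condition in
  \<open>children\<close> keeps \<open>r\<close> from being its own child.\<close>

definition par :: "'a \<Rightarrow> 'a" where
  "par y = X (dep y - 1) y"

definition desc :: "'a \<Rightarrow> 'a set" where
  "desc x = {t \<in> V. dep x \<le> dep t \<and> X (dep x) t = x}"

definition children :: "'a \<Rightarrow> 'a set" where
  "children v = {y \<in> V. dep y = Suc (dep v) \<and> par y = v}"

definition touching :: "'a \<Rightarrow> bool" where
  "touching y \<longleftrightarrow> (\<exists>u\<in>desc y. {r, u} \<in> E)"

definition multi :: "'a \<Rightarrow> bool" where
  "multi y \<longleftrightarrow> (\<exists>w\<in>desc y. w \<noteq> y \<and> {par y, w} \<in> E)"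

text \<open>Only these children need labels: infinite subtrees will be separated by special
  vertices, and finite touching ones will occur at most once per parent.\<close>

definition inner_children :: "'a \<Rightarrow> 'a set" where
  "inner_children v = {y \<in> children v. finite (desc y) \<and> \<not> touching y}"

lemma dep_r [simp]: "dep r = 0"
  using dep_X[OF root_V, of 0] X_0[OF root_V] by simp

lemma dep_0: "t \<in> V \<Longrightarrow> dep t = 0 \<Longrightarrow> t = r"
  using X_0 X_dep by metis

lemma par:
  assumes "t \<in> V" "t \<noteq> r"
  shows "par t \<in> V" "dep t = Suc (dep (par t))" "{par t, t} \<in> E"
    and "n \<le> dep (par t) \<Longrightarrow> X n (par t) = X n t"
proof -
  obtain m where m: "dep t = Suc m" using dep_0[OF assms(1)] assms(2) by (cases "dep t") auto
  show V: "par t \<in> V" unfolding par_def using X_V[OF assms(1)] by simp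
  show d: "dep t = Suc (dep (par t))" unfolding par_def using dep_X[OF assms(1), of m] m by simp
  show "{par t, t} \<in> E" unfolding par_def using X_edge[OF assms(1), of m] X_dep[OF assms(1)] m by simp
  show "n \<le> dep (par t) \<Longrightarrow> X n (par t) = X n t"
    using X_X[OF assms(1), of n "dep (par t)"] d m unfolding par_def by simp
qed

lemma edge_sym: "{x, y} \<in> E \<Longrightarrow> {y, x} \<in> E"
  by (simp add: insert_commute)

lemma edge_dep: "{u, w} \<in> E \<Longrightarrow> dep u \<noteq> dep w"
  using edge_comparable edge_V X_dep by (metis order_refl)

lemma edge_X:
  assumes "{u, w} \<in> E" "n \<le> dep u" "n \<le> dep w"
  shows "X n u = X n w"
proof -
  have *: "X n a = X n b" if "{a, b} \<in> E" "n \<le> dep a" "dep a \<le> dep b" for a b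
    using X_X[of b n "dep a"] edge_comparable[OF that(1,3)] edge_V[OF that(1)] that(2,3) by auto
  show ?thesis using *[of u w] *[of w u] assms edge_sym by (metis linear)
qed

lemma desc_V: "desc x \<subseteq> V"
  by (auto simp: desc_def)

lemma desc_self: "x \<in> V \<Longrightarrow> x \<in> desc x"
  by (simp add: desc_def X_dep)

lemma desc_dep: "t \<in> desc x \<Longrightarrow> dep x \<le> dep t"
  by (simp add: desc_def)

lemma desc_X: "t \<in> desc x \<Longrightarrow> X (dep x) t = x"
  by (simp add: desc_def)

lemma desc_dep_less: "t \<in> desc x \<Longrightarrow> t \<noteq> x \<Longrightarrow> dep x < dep t"
  using X_dep unfolding desc_def by (auto simp: le_less)

lemma in_desc_X: "t \<in> V \<Longrightarrow> n \<le> dep t \<Longrightarrow> t \<in> desc (X n t)"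
  by (simp add: desc_def dep_X)

lemma desc_trans: "t \<in> desc y \<Longrightarrow> y \<in> desc x \<Longrightarrow> t \<in> desc x"
  unfolding desc_def using X_X by fastforce

lemma desc_disjoint: "t \<in> desc x \<Longrightarrow> t \<in> desc y \<Longrightarrow> dep x = dep y \<Longrightarrow> x = y"
  using desc_X by metis

lemma edge_desc: "{u, w} \<in> E \<Longrightarrow> dep u < dep w \<Longrightarrow> w \<in> desc u"
  using edge_comparable edge_V unfolding desc_def by auto

lemma par_in_desc: "t \<in> desc x \<Longrightarrow> t \<noteq> x \<Longrightarrow> x \<in> V \<Longrightarrow> par t \<in> desc x"
proof -
  assume t: "t \<in> desc x" "t \<noteq> x" "x \<in> V"
  have d: "dep x < dep t" using desc_dep_less t by blast
  then have "t \<noteq> r" by auto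
  then show ?thesis using par[of t, OF _ \<open>t \<noteq> r\<close>] t d unfolding desc_def by auto
qed

lemma childrenD:
  assumes "y \<in> children v"
  shows "y \<in> V" "y \<noteq> r" "par y = v" "dep y = Suc (dep v)" "{v, y} \<in> E" "v \<in> V" "y \<in> desc v"
proof -
  show y: "y \<in> V" "par y = v" "dep y = Suc (dep v)" using assms by (auto simp: children_def)
  then show "y \<noteq> r" by auto
  then show "{v, y} \<in> E" "v \<in> V" using par y by blast+
  then show "y \<in> desc v" using edge_desc y by simp
qed

lemma child_par: "t \<in> V \<Longrightarrow> t \<noteq> r \<Longrightarrow> t \<in> children (par t)"
  using par by (simp add: children_def)

lemma desc_child:
  assumes "t \<in> desc v" "t \<noteq> v" "v \<in> V"
  shows "\<exists>y\<in>children v. t \<in> desc y"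
proof -
  have d: "dep v < dep t" using desc_dep_less assms by blast
  have t: "t \<in> V" using assms desc_V by blast
  let ?y = "X (Suc (dep v)) t"
  have y: "?y \<in> V" "dep ?y = Suc (dep v)" using X_V[OF t] dep_X[OF t] d by auto
  have "par ?y = v" unfolding par_def y(2) using X_X[OF t, of "dep v" "Suc (dep v)"] d desc_X[OF assms(1)] by simp
  then show ?thesis using y in_desc_X[OF t, of "Suc (dep v)"] d by (auto simp: children_def)
qed

lemma finite_children: "finite (children v)"
  by (rule finite_subset[OF _ fin_nb[of v]]) (auto dest: childrenD)

lemma child_desc_subset: "y \<in> children v \<Longrightarrow> desc y \<subseteq> desc v"
  using desc_trans childrenD by blast

lemma desc_eq: "v \<in> V \<Longrightarrow> desc v = insert v (\<Union>y\<in>children v. desc y)"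
  using desc_child[of _ v] child_desc_subset desc_self[of v] by (intro equalityI subsetI) blast+

lemma infinite_child:
  assumes "v \<in> V" "infinite (desc v)"
  shows "\<exists>y\<in>children v. infinite (desc y)"
  using assms desc_eq[OF assms(1)] finite_children by (metis finite_UN finite_insert)

lemma desc_induct [consumes 2, case_names base step]:
  assumes "z \<in> desc y" "y \<in> V" "P y"
    and "\<And>u w. u \<in> desc y \<Longrightarrow> P u \<Longrightarrow> w \<in> desc y \<Longrightarrow> w \<in> children u \<Longrightarrow> P w"
  shows "P z"
  using assms(1)
proof (induction "dep z" arbitrary: z rule: less_induct)
  case less
  show ?case
  proof (cases "z = y")
    case False
    have "z \<noteq> r" using desc_dep_less[OF less.prems False] by auto
    then have p: "dep (par z) < dep z" "z \<in> children (par z)"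
      using par(2)[of z] child_par[of z] subsetD[OF desc_V less.prems] by auto
    have "par z \<in> desc y" using par_in_desc[OF less.prems False assms(2)] .
    then show ?thesis using less.hyps[OF p(1)] p(2) assms(4) less.prems by blast
  qed (use assms in simp)
qed

definition marked :: "('a set \<Rightarrow> nat) \<Rightarrow> bool" where
  "marked \<phi> \<longleftrightarrow> (\<forall>v. \<forall>y\<in>children v. \<forall>w\<in>desc y. w \<noteq> y \<longrightarrow> {v, w} \<in> E \<longrightarrow> \<phi> {v, w} < \<phi> {v, y})"

text \<open>Both \<sigma> and its inverse keep depths up to \<open>n\<close>, so deeper vertices go
  to deeper ones, and a subtree rooted at depth \<open>Suc n\<close>, being connected, is mapped
  into one such subtree. If its top did not go to the top, \<open>marked\<close> would order the
  colours of two edges one way before and the other way after applying \<sigma>.\<close>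

lemma tree_aut_step:
  assumes marked: "marked \<phi>"
    and IH: "\<And>\<sigma> t. colour_aut V E \<phi> \<sigma> \<Longrightarrow> \<sigma> r = r \<Longrightarrow> t \<in> V \<Longrightarrow> dep t \<le> n \<Longrightarrow> dep (\<sigma> t) = dep t"
    and \<sigma>: "colour_aut V E \<phi> \<sigma>" "\<sigma> r = r" and y: "y \<in> V" "dep y = Suc n"
  shows "dep (\<sigma> y) = Suc n \<and> par (\<sigma> y) = \<sigma> (par y)"
proof -
  define \<tau> where "\<tau> = inv_into V \<sigma>"
  have EV: "\<forall>a b. {a, b} \<in> E \<longrightarrow> a \<in> V \<and> b \<in> V" using edge_V by blast
  note inv = colour_aut_inv_into[OF \<sigma>(1) EV, folded \<tau>_def]
  have \<tau>: "colour_aut V E \<phi> \<tau>" "\<tau> r = r" using inv \<sigma>(2) root_V by metis+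
  have deep: "Suc n \<le> dep (\<rho> t)"
    if "colour_aut V E \<phi> \<rho>" "colour_aut V E \<phi> \<rho>'" "\<rho>' r = r" "t \<in> V" "\<rho>' (\<rho> t) = t" "Suc n \<le> dep t"
    for \<rho> \<rho>' t
    using IH[OF that(2,3), of "\<rho> t"] colour_aut_V[OF that(1,4)] that(5,6) by (metis not_less_eq_eq)
  have deep\<sigma>: "Suc n \<le> dep (\<sigma> t)" if "t \<in> V" "Suc n \<le> dep t" for t
    using deep[OF \<sigma>(1) \<tau> that(1) inv(3) that(2)] that by blast
  have deep\<tau>: "Suc n \<le> dep (\<tau> t)" if "t \<in> V" "Suc n \<le> dep t" for t
    using deep[OF \<tau>(1) \<sigma> that(1) inv(2) that(2)] that by blast
  have same: "X (Suc n) (\<rho> z) = X (Suc n) (\<rho> a)"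
    if \<rho>: "colour_aut V E \<phi> \<rho>" "\<And>t. t \<in> V \<Longrightarrow> Suc n \<le> dep t \<Longrightarrow> Suc n \<le> dep (\<rho> t)"
      and a: "a \<in> V" "dep a = Suc n" and z: "z \<in> desc a" for \<rho> z a
    using z a(1)
  proof (induction rule: desc_induct)
    case (step u w)
    have uw: "u \<in> V" "w \<in> V" "Suc n \<le> dep u" "Suc n \<le> dep w"
      using step desc_V desc_dep[of u a] desc_dep[of w a] a by auto
    then have "{\<rho> u, \<rho> w} \<in> E"
      using colour_aut_edge[OF \<rho>(1)] childrenD(5)[OF step.hyps(3)] by blast
    then show ?case using edge_X \<rho>(2) uw step by metis
  qed simp
  have yr: "y \<noteq> r" using y by auto
  let ?v = "par y"
  note v = par[OF y(1) yr]
  have sy: "\<sigma> y \<in> V" "Suc n \<le> dep (\<sigma> y)" using colour_aut_V[OF \<sigma>(1) y(1)] deep\<sigma>[OF y(1)] y(2) by auto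
  define y' where "y' = X (Suc n) (\<sigma> y)"
  have y': "y' \<in> V" "dep y' = Suc n" "\<sigma> y \<in> desc y'"
    unfolding y'_def using X_V dep_X in_desc_X sy by auto
  have y'r: "y' \<noteq> r" using y' by auto
  have sv: "\<sigma> ?v \<in> V" "dep (\<sigma> ?v) = n" using colour_aut_V[OF \<sigma>(1) v(1)] IH[OF \<sigma> v(1)] v(2) y(2) by auto
  have svy: "{\<sigma> ?v, \<sigma> y} \<in> E" using colour_aut_edge[OF \<sigma>(1) v(1) y(1)] v(3) by simp
  have "X n y' = \<sigma> ?v"
    unfolding y'_def using edge_comparable[OF svy] X_X[OF sy(1), of n "Suc n"] sv sy by simp
  then have par': "par y' = \<sigma> ?v" by (simp add: par_def[of y'] y'(2))
  \<comment> \<open>The vertex sent to the top \<open>y'\<close>. It lies in the subtree of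
    \<open>y\<close> and is adjacent to the parent of \<open>y\<close>; it has to be
    \<open>y\<close> itself.\<close>
  define z where "z = \<tau> y'"
  have z: "z \<in> V" "\<sigma> z = y'" unfolding z_def using colour_aut_V[OF \<tau>(1) y'(1)] inv(2)[OF y'(1)] by auto
  have zd: "z \<in> desc y"
  proof -
    have "X (Suc n) (\<tau> (\<sigma> y)) = X (Suc n) (\<tau> y')"
      by (rule same[OF \<tau>(1) deep\<tau> y'(1,2,3)])
    then have "X (Suc n) z = y" unfolding z_def inv(3)[OF y(1)] using X_dep[OF y(1)] y(2) by simp
    then show ?thesis using deep\<tau>[OF y'(1)] y'(2) z(1) y(2) by (simp add: desc_def z_def)
  qed
  have "{\<sigma> ?v, y'} \<in> E" using par(3)[OF y'(1) y'r] par' by simp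
  then have vz: "{?v, z} \<in> E" using colour_aut_edge[OF \<sigma>(1) v(1) z(1)] z(2) by simp
  have "z = y"
  proof (rule ccontr)
    assume ne: "z \<noteq> y"
    have "\<phi> {?v, z} < \<phi> {?v, y}"
      using marked child_par[OF y(1) yr] zd ne vz unfolding marked_def by blast
    moreover have "\<sigma> y \<noteq> y'" using colour_aut_inj[OF \<sigma>(1) y(1) z(1)] z(2) ne by auto
    then have "\<phi> {\<sigma> ?v, \<sigma> y} < \<phi> {\<sigma> ?v, y'}"
      using marked child_par[OF y'(1) y'r] y'(3) svy unfolding marked_def par' by blast
    then have "\<phi> {?v, y} < \<phi> {?v, z}"
      using colour_aut_colour[OF \<sigma>(1) v(3)] colour_aut_colour[OF \<sigma>(1) vz] z(2) by simp
    ultimately show False by simp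
  qed
  then show ?thesis using z(2) y'(2) par' by simp
qed

text \<open>The induction runs over all automorphisms at once because the step applies its
  hypothesis to the inverse too.\<close>

lemma tree_aut_dep:
  assumes marked: "marked \<phi>"
  shows "colour_aut V E \<phi> \<sigma> \<Longrightarrow> \<sigma> r = r \<Longrightarrow> t \<in> V \<Longrightarrow> dep (\<sigma> t) = dep t"
proof (induction "dep t" arbitrary: \<sigma> t rule: less_induct)
  case less
  show ?case
  proof (cases "dep t")
    case 0
    then show ?thesis using dep_0 less.prems by simp
  next
    case (Suc n)
    then show ?thesis
      using tree_aut_step[OF marked, of n \<sigma> t] less.hyps less.prems by simp
  qed
qed

end

section \<open>Invariance of the tree notions under automorphisms\<close>

locale tree_aut = normal_tree +
  fixes \<phi> \<sigma>
  assumes marked: "marked \<phi>" and aut: "colour_aut V E \<phi> \<sigma>" and aut_root: "\<sigma> r = r"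
begin

lemmas aut_V = colour_aut_V[OF aut]
  and aut_inj = colour_aut_inj[OF aut]
  and aut_edge = colour_aut_edge[OF aut]
  and aut_colour = colour_aut_colour[OF aut]
  and aut_surj = colour_aut_surj[OF aut]
  and aut_dep = tree_aut_dep[OF marked aut aut_root]

lemma aut_par:
  assumes "t \<in> V" "t \<noteq> r"
  shows "par (\<sigma> t) = \<sigma> (par t)"
  using tree_aut_step[OF marked _ aut aut_root assms(1), of "dep (par t)"]
    tree_aut_dep[OF marked] par(2)[OF assms] by blast

lemma aut_not_root: "t \<in> V \<Longrightarrow> \<sigma> t = r \<longleftrightarrow> t = r"
  using aut_inj[OF _ root_V] aut_root by metis

lemma aut_X: "t \<in> V \<Longrightarrow> n \<le> dep t \<Longrightarrow> X n (\<sigma> t) = \<sigma> (X n t)"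
proof (induction "dep t" arbitrary: t rule: less_induct)
  case less
  show ?case
  proof (cases "n = dep t")
    case True
    then show ?thesis using X_dep[OF less.prems(1)] X_dep[OF aut_V[OF less.prems(1)]] aut_dep less.prems by simp
  next
    case False
    then have tr: "t \<noteq> r" using less.prems by auto
    note p = par[OF less.prems(1) tr]
    have st: "\<sigma> t \<in> V" "\<sigma> t \<noteq> r" using aut_V aut_not_root less.prems(1) tr by auto
    have n: "n \<le> dep (par t)" using False less.prems(2) p(2) by simp
    have "X n (\<sigma> t) = X n (par (\<sigma> t))"
      using par(4)[OF st, of n] n aut_par[OF less.prems(1) tr] aut_dep[OF p(1)] by simp
    also have "\<dots> = \<sigma> (X n t)"
      unfolding aut_par[OF less.prems(1) tr] using less.hyps[OF _ p(1) n] p(2) p(4)[OF n] by simp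
    finally show ?thesis .
  qed
qed

lemma aut_desc_iff: "x \<in> V \<Longrightarrow> t \<in> V \<Longrightarrow> \<sigma> t \<in> desc (\<sigma> x) \<longleftrightarrow> t \<in> desc x"
  unfolding desc_def using aut_dep aut_X aut_V aut_inj X_V by auto

lemma aut_desc: "x \<in> V \<Longrightarrow> desc (\<sigma> x) = \<sigma> ` desc x"
proof
  show "x \<in> V \<Longrightarrow> desc (\<sigma> x) \<subseteq> \<sigma> ` desc x"
  proof
    fix t assume x: "x \<in> V" and t: "t \<in> desc (\<sigma> x)"
    obtain u where "u \<in> V" "\<sigma> u = t" using aut_surj t desc_V by blast
    then show "t \<in> \<sigma> ` desc x" using aut_desc_iff[OF x] t by blast
  qed
  show "x \<in> V \<Longrightarrow> \<sigma> ` desc x \<subseteq> desc (\<sigma> x)"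
    using aut_desc_iff desc_V by blast
qed

lemma inj_on_aut: "S \<subseteq> V \<Longrightarrow> inj_on \<sigma> S"
  using aut_inj by (meson inj_onI subset_iff)

lemma aut_finite_desc: "x \<in> V \<Longrightarrow> finite (desc (\<sigma> x)) \<longleftrightarrow> finite (desc x)"
  unfolding aut_desc using finite_image_iff[OF inj_on_aut[OF desc_V]] by blast

lemma aut_touching:
  assumes "x \<in> V"
  shows "touching (\<sigma> x) \<longleftrightarrow> touching x"
proof -
  have "{r, \<sigma> u} \<in> E \<longleftrightarrow> {r, u} \<in> E" if "u \<in> desc x" for u
    using aut_edge[OF root_V, of u] aut_root desc_V that by auto
  then show ?thesis unfolding touching_def aut_desc[OF assms] by simp
qed

lemma aut_children: "v \<in> V \<Longrightarrow> children (\<sigma> v) = \<sigma> ` children v"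
proof -
  assume v: "v \<in> V"
  have "\<sigma> t \<in> children (\<sigma> v) \<longleftrightarrow> t \<in> children v" if "t \<in> V" for t
  proof (cases "t = r")
    case True
    then show ?thesis by (simp add: children_def aut_root)
  next
    case False
    then show ?thesis
      using aut_par[OF that] aut_dep[OF that] aut_dep[OF v] aut_V[OF that] aut_inj[OF _ v] par(1)[OF that] that
      by (auto simp: children_def)
  qed
  moreover have "children (\<sigma> v) \<subseteq> \<sigma> ` V" using aut_surj childrenD(1) by blast
  ultimately show ?thesis using childrenD(1)[of _ v] by (intro equalityI subsetI) auto
qed

lemma aut_multi:
  assumes "y \<in> children v"
  shows "multi (\<sigma> y) \<longleftrightarrow> multi y"
proof -
  note y = childrenD[OF assms]
  have "{\<sigma> v, \<sigma> w} \<in> E \<longleftrightarrow> {v, w} \<in> E" "\<sigma> w = \<sigma> y \<longleftrightarrow> w = y" if "w \<in> desc y" for w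
    using aut_edge aut_inj y that desc_V by blast+
  then show ?thesis
    unfolding multi_def aut_par[OF y(1,2)] y(3) aut_desc[OF y(1)] by auto
qed

lemma aut_inner_children: "v \<in> V \<Longrightarrow> inner_children (\<sigma> v) = \<sigma> ` inner_children v"
  unfolding inner_children_def aut_children
  using aut_finite_desc aut_touching childrenD(1) by auto

end

section \<open>The colouring\<close>

context normal_tree
begin

text \<open>
  Edges to the root do not count: their colours are needed for recognising the root.
\<close>

definition has_back :: "'a \<Rightarrow> bool" where
  "has_back w \<longleftrightarrow> (\<exists>u. u \<noteq> r \<and> u \<noteq> par w \<and> {u, w} \<in> E \<and> dep u < dep w)"

lemma down_edge:
  assumes "{v, w} \<in> E" "dep v < dep w"
  shows "w \<in> children v \<or> (\<exists>y\<in>children v. w \<in> desc y \<and> w \<noteq> y \<and> multi y)"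
proof -
  have w: "w \<in> desc v" "w \<noteq> v" "v \<in> V" using edge_desc[OF assms] edge_V assms by auto
  then obtain y where y: "y \<in> children v" "w \<in> desc y" using desc_child by blast
  have "w \<noteq> y \<Longrightarrow> multi y"
    using y(2) assms(1) unfolding multi_def childrenD(3)[OF y(1)] by blast
  then show ?thesis using y by blast
qed

lemma par_desc_child:
  assumes "y \<in> children v" "w \<in> desc y" "w \<noteq> y"
  shows "par w \<noteq> v" "w \<noteq> r" "dep v < dep w"
proof -
  note y = childrenD[OF assms(1)]
  have d: "dep y < dep w" using desc_dep_less assms by blast
  then show "w \<noteq> r" "dep v < dep w" using y by auto
  moreover have "w \<in> V" using assms desc_V by blast
  ultimately show "par w \<noteq> v" using par(2)[of w] d y by auto
qed

lemma touching_child_root: "y \<in> children r \<Longrightarrow> touching y"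
  unfolding touching_def using childrenD(5) desc_self[OF childrenD(1)] by blast

lemma inner_childrenD:
  assumes "y \<in> inner_children v"
  shows "y \<in> children v" "finite (desc y)" "\<not> touching y" "v \<noteq> r"
proof -
  show y: "y \<in> children v" "finite (desc y)" "\<not> touching y"
    using assms by (simp_all add: inner_children_def)
  then show "v \<noteq> r" using touching_child_root by blast
qed

lemma inner_children_inner:
  assumes "y \<in> inner_children v"
  shows "inner_children y = children y"
proof -
  note y = inner_childrenD[OF assms]
  have "w \<in> children y \<Longrightarrow> w \<in> inner_children y" for w
    using y child_desc_subset[of w y] finite_subset unfolding inner_children_def touching_def by blast
  then show ?thesis unfolding inner_children_def by blast
qed

lemma finite_inner_children: "finite (inner_children v)"
  using finite_children unfolding inner_children_def by simp

end

text \<open>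
  \<open>rc\<close> gives the colours of the tree edges at the root and \<open>val\<close> the labels modulo \<open>d\<close>; \<open>C2 v\<close> consists
  of the children of \<open>v\<close> with a finite subtree avoiding the neighbours of the root whose edge to \<open>v\<close>
  is not coloured 1; a leaf \<open>y\<close> has its edges to \<open>L y\<close> coloured 1. A vertex of \<open>W\<close> is marked by
  colour 1 on its non-tree edges upwards, failing that by label sum 1 over \<open>C2\<close> instead of 0, and
  failing that by colour 3 instead of 2 on the edges to its children.
\<close>

locale coloured_tree = normal_tree +
  fixes rc :: "'a \<Rightarrow> nat" and d :: nat and val :: "'a \<Rightarrow> nat" and C2 :: "'a \<Rightarrow> 'a set"
    and L :: "'a \<Rightarrow> 'a set" and W :: "'a set"
  assumes rc_range: "rc y \<in> {1, 3}"
    and rc_multi: "y \<in> children r \<Longrightarrow> multi y \<Longrightarrow> rc y = 3"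
    and C2_subset: "C2 v \<subseteq> inner_children v"
    and C2_nonempty: "inner_children v \<noteq> {} \<Longrightarrow> C2 v \<noteq> {}"
    and C2_multi: "y \<in> inner_children v \<Longrightarrow> multi y \<Longrightarrow> y \<in> C2 v"
    and val_inj_C2: "inj_on val (C2 v)"
    and val_inj_C1: "inj_on val (inner_children v - C2 v)"
    and val_less: "y \<in> inner_children v \<Longrightarrow> val y < d"
    and val_sum_inner: "v \<in> inner_children u \<Longrightarrow> inner_children v \<noteq> {} \<Longrightarrow> sum val (C2 v) mod d = val v"
    and val_sum_infinite: "infinite (desc v) \<Longrightarrow> v \<in> V \<Longrightarrow> v \<noteq> r \<Longrightarrow> inner_children v \<noteq> {} \<Longrightarrow>
      sum val (C2 v) mod d = (if v \<in> W \<and> \<not> has_back v then 1 else 0) mod d"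
    and L_leaf: "y \<in> inner_children v \<Longrightarrow> desc y = {y} \<Longrightarrow>
      L y \<subseteq> {u. {u, y} \<in> E \<and> u \<noteq> par y} \<and> card (L y) = val y"
    and L_infinite: "infinite (desc y) \<Longrightarrow> L y = {}"
    and W_infinite: "w \<in> W \<Longrightarrow> w \<in> V \<and> infinite (desc w) \<and> 2 \<le> dep w \<and> {r, w} \<notin> E"
    and W_inner: "w \<in> W \<Longrightarrow> \<not> has_back w \<Longrightarrow> inner_children w \<noteq> {} \<Longrightarrow> 2 \<le> d"
    and W_single: "w \<in> W \<Longrightarrow> \<not> has_back w \<Longrightarrow> inner_children w = {} \<Longrightarrow> y \<in> children w \<Longrightarrow>
      infinite (desc y) \<and> \<not> multi y"
    and W_dep: "w \<in> W \<Longrightarrow> w' \<in> W \<Longrightarrow> dep w = dep w' \<Longrightarrow> w = w'"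
    and W_everywhere: "x \<in> V \<Longrightarrow> infinite (desc x) \<Longrightarrow> W \<inter> desc x \<noteq> {}"
    and touching_unique: "y \<in> children v \<Longrightarrow> y' \<in> children v \<Longrightarrow> finite (desc y) \<Longrightarrow> finite (desc y') \<Longrightarrow>
      touching y \<Longrightarrow> touching y' \<Longrightarrow> y = y'"
begin

definition back_colour :: "'a \<Rightarrow> 'a \<Rightarrow> nat" where
  "back_colour u w = (if u = r \<or> u \<in> L w \<or> w \<in> W \<and> has_back w then 1 else 2)"

text \<open>In the \<open>multi\<close> case the colour is one more than the largest other colour from \<open>par y\<close> into \<open>desc y\<close>.\<close>

definition tree_colour :: "'a \<Rightarrow> nat" where
  "tree_colour y =
    (if par y = r then rc y
     else if multi y then
       (if \<exists>w\<in>desc y. w \<noteq> y \<and> {par y, w} \<in> E \<and> back_colour (par y) w = 2 then 3 else 2)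
     else if finite (desc y) then (if touching y \<or> y \<in> C2 (par y) then 2 else 1)
     else if par y \<in> W \<and> \<not> has_back (par y) \<and> inner_children (par y) = {} then 3 else 2)"

text \<open>The colour has to be a function of the unordered edge; its ends are recovered by depth,
  which differs at the two ends by normality.\<close>

definition upper :: "'a set \<Rightarrow> 'a" where
  "upper e = (ARG_MIN dep u. u \<in> e)"

definition lower :: "'a set \<Rightarrow> 'a" where
  "lower e = the_elem (e - {upper e})"

definition colour :: "'a set \<Rightarrow> nat" where
  "colour e = (if upper e = par (lower e) then tree_colour (lower e)
     else back_colour (upper e) (lower e))"

lemma upper_lower:
  assumes "dep u < dep w"
  shows "upper {u, w} = u" "lower {u, w} = w"
proof -
  have "upper {u, w} \<in> {u, w} \<and> dep (upper {u, w}) \<le> dep u"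
    unfolding upper_def using arg_min_natI[of "\<lambda>x. x \<in> {u, w}" u dep]
      arg_min_nat_le[of "\<lambda>x. x \<in> {u, w}" u dep] by simp
  then show up: "upper {u, w} = u" using assms by auto
  have "{u, w} - {u} = {w}" using assms by auto
  then show "lower {u, w} = w" unfolding lower_def up by simp
qed

lemma colour_child: "y \<in> children v \<Longrightarrow> colour {v, y} = tree_colour y"
  using upper_lower[of v y] childrenD[of y v] by (simp add: colour_def)

lemma colour_back: "dep u < dep w \<Longrightarrow> u \<noteq> par w \<Longrightarrow> colour {u, w} = back_colour u w"
  using upper_lower[of u w] by (simp add: colour_def)

lemma back_colour_range: "back_colour u w \<in> {1, 2}"
  by (simp add: back_colour_def)

lemma back_colour_root: "back_colour r w = 1"
  by (simp add: back_colour_def)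

lemma tree_colour_range: "tree_colour y \<in> {1, 2, 3}"
  using rc_range[of y] by (auto simp: tree_colour_def)

lemma colour_range: "colour e \<in> {1, 2, 3}"
  using tree_colour_range[of "lower e"] back_colour_range[of "upper e" "lower e"]
  by (auto simp: colour_def)

lemma tree_colour_infinite:
  "infinite (desc y) \<Longrightarrow> par y \<noteq> r \<Longrightarrow> tree_colour y \<in> {2, 3}"
  by (simp add: tree_colour_def)

text \<open>At the root the other edges into the subtree have colour 1, while
  \<open>rc_multi\<close> gives 3 to the tree edge. Elsewhere non-tree edges have colour at most 2,
  and the tree edge exceeds the largest one present.\<close>

lemma marked: "marked colour"
  unfolding marked_def
proof (intro allI ballI impI)
  fix v y w assume y: "y \<in> children v" and w: "w \<in> desc y" "w \<noteq> y" "{v, w} \<in> E"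
  have multi: "multi y" using w childrenD(3)[OF y] unfolding multi_def by blast
  have "colour {v, w} = back_colour v w"
    using colour_back par_desc_child[OF y w(1,2)] by metis
  moreover have "back_colour v w < tree_colour y"
  proof (cases "v = r")
    case True
    then show ?thesis using rc_multi multi y childrenD(3)[OF y]
      by (simp add: tree_colour_def back_colour_root)
  next
    case False
    then show ?thesis using back_colour_range[of v w] multi w childrenD(3)[OF y]
      by (auto simp: tree_colour_def)
  qed
  ultimately show "colour {v, w} < colour {v, y}" using colour_child[OF y] by simp
qed

text \<open>Makes the classes visible in the colours. A child with further edges into its subtree
  gets a colour of at least 2, and \<open>C2_multi\<close> puts all of these into
  \<open>C2 v\<close>.\<close>

lemma C2_colour:
  assumes "y \<in> inner_children v"
  shows "y \<in> C2 v \<longleftrightarrow> colour {v, y} \<noteq> 1"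
  using inner_childrenD[OF assms] C2_multi[OF assms] childrenD(3)
  by (simp add: colour_child tree_colour_def)

text \<open>Makes the leaf labels visible. The neighbours of a leaf lie above it, none of them is
  the root since \<open>y\<close> is not touching, and a leaf is not in \<open>W\<close>; so
  \<open>L y\<close> is the only source of colour 1 on its non-tree edges.\<close>

lemma L_colour:
  assumes "y \<in> inner_children v" "desc y = {y}"
  shows "L y = {u. {u, y} \<in> E \<and> u \<noteq> v \<and> colour {u, y} = 1}"
proof -
  note y = inner_childrenD[OF assms(1)]
  note c = childrenD[OF y(1)]
  have "y \<notin> W" using W_infinite assms(2) by (metis finite.emptyI finite_insert)
  have nb: "u \<noteq> r \<and> dep u < dep y" if "{u, y} \<in> E" for u
  proof -
    have "u \<noteq> r" using that y(3) assms(2) unfolding touching_def by auto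
    moreover have "u \<notin> desc y" using that edge_V assms(2) by blast
    then have "\<not> dep y < dep u" using edge_desc edge_sym that by blast
    ultimately show ?thesis using edge_dep[OF that] by auto
  qed
  have "colour {u, y} = 1 \<longleftrightarrow> u \<in> L y" if "{u, y} \<in> E" "u \<noteq> v" for u
    using nb[OF that(1)] colour_back[of u y] that(2) c(3) \<open>y \<notin> W\<close> by (simp add: back_colour_def)
  then show ?thesis using L_leaf[OF assms] c(3) by auto
qed

end

section \<open>Rigidity of the colouring once the root is fixed\<close>

locale coloured_tree_aut = coloured_tree +
  fixes \<sigma>
  assumes is_aut: "colour_aut V E colour \<sigma>" and fixes_root: "\<sigma> r = r"

sublocale coloured_tree_aut \<subseteq> tree_aut V E r X dep colour \<sigma>
  by unfold_locales (use marked is_aut fixes_root in auto)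

context coloured_tree_aut
begin

lemma aut_C2:
  assumes "v \<in> V"
  shows "C2 (\<sigma> v) = \<sigma> ` C2 v"
proof -
  have *: "\<sigma> y \<in> C2 (\<sigma> v) \<longleftrightarrow> y \<in> C2 v" if "y \<in> inner_children v" for y
    using C2_colour[OF that] C2_colour[of "\<sigma> y" "\<sigma> v"] aut_inner_children[OF assms] that
      aut_colour[OF childrenD(5)[OF inner_childrenD(1)[OF that]]] by auto
  show ?thesis
  proof (intro equalityI subsetI)
    fix t assume t: "t \<in> C2 (\<sigma> v)"
    then obtain y where "y \<in> inner_children v" "t = \<sigma> y"
      using C2_subset[of "\<sigma> v"] unfolding aut_inner_children[OF assms] by blast
    then show "t \<in> \<sigma> ` C2 v" using * t by blast
  next
    fix t assume "t \<in> \<sigma> ` C2 v"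
    then show "t \<in> C2 (\<sigma> v)" using * C2_subset[of v] by blast
  qed
qed

lemma sum_C2_aut:
  assumes "v \<in> V" "\<And>y. y \<in> C2 v \<Longrightarrow> val (\<sigma> y) = val y"
  shows "sum val (C2 (\<sigma> v)) = sum val (C2 v)"
proof -
  have "C2 v \<subseteq> V" using C2_subset[of v] inner_childrenD(1) childrenD(1) by blast
  then show ?thesis
    unfolding aut_C2[OF assms(1)] using assms(2) by (subst sum.reindex[OF inj_on_aut]) auto
qed

lemma aut_inner_child: "y \<in> inner_children v \<Longrightarrow> \<sigma> y \<in> inner_children (\<sigma> v)"
  using aut_inner_children childrenD(6) inner_childrenD(1) by blast

text \<open>Induction on the size of the subtree: the label of a leaf counts its non-tree edges of
  colour 1, that of an inner vertex is the label sum over \<open>C2\<close> modulo \<open>d\<close>,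
  and both are preserved.\<close>

lemma aut_val: "y \<in> inner_children v \<Longrightarrow> val (\<sigma> y) = val y"
proof (induction "card (desc y)" arbitrary: y v rule: less_induct)
  case less
  note y = inner_childrenD[OF less.prems]
  note c = childrenD[OF y(1)]
  note sy = aut_inner_child[OF less.prems]
  show ?case
  proof (cases "children y = {}")
    case True
    have leaf: "desc y = {y}" using desc_eq[OF c(1)] True by simp
    have sleaf: "desc (\<sigma> y) = {\<sigma> y}" unfolding aut_desc[OF c(1)] leaf by simp
    have LV: "L y \<subseteq> V" using L_leaf[OF less.prems leaf] edge_V by blast
    have "\<sigma> u \<in> L (\<sigma> y) \<longleftrightarrow> u \<in> L y" if "u \<in> V" for u
      unfolding L_colour[OF less.prems leaf] L_colour[OF sy sleaf]
      using aut_edge[OF that c(1)] aut_inj[OF that c(6)] aut_colour[of u y] by auto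
    moreover have "L (\<sigma> y) \<subseteq> V" using L_leaf[OF sy sleaf] edge_V by blast
    ultimately have "L (\<sigma> y) = \<sigma> ` L y" using LV aut_surj by blast
    then have "card (L (\<sigma> y)) = card (L y)" using card_image[OF inj_on_aut[OF LV]] by simp
    then show ?thesis using L_leaf[OF less.prems leaf] L_leaf[OF sy sleaf] by simp
  next
    case False
    have ne: "inner_children y \<noteq> {}" using inner_children_inner[OF less.prems] False by simp
    have sne: "inner_children (\<sigma> y) \<noteq> {}" using aut_inner_children[OF c(1)] ne by simp
    have "val (\<sigma> w) = val w" if "w \<in> C2 y" for w
    proof -
      have w: "w \<in> inner_children y" using that C2_subset by blast
      note cw = childrenD[OF inner_childrenD(1)[OF w]]
      have "y \<notin> desc w" using cw desc_dep[of y w] by auto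
      then have "desc w \<subset> desc y"
        using child_desc_subset[OF inner_childrenD(1)[OF w]] desc_self[OF c(1)] by blast
      then show ?thesis using less.hyps[OF _ w] psubset_card_mono[OF y(2)] by blast
    qed
    then show ?thesis
      using val_sum_inner[OF less.prems ne] val_sum_inner[OF sy sne] sum_C2_aut[OF c(1)] by simp
  qed
qed

text \<open>Each of the three marks is visible in the colours, so the image is again in
  \<open>W\<close>; it has the same depth, and \<open>W_dep\<close> allows one special vertex per
  depth.\<close>

lemma aut_W:
  assumes w: "w \<in> W"
  shows "\<sigma> w = w"
proof -
  have wV: "w \<in> V" "infinite (desc w)" "2 \<le> dep w" using W_infinite[OF w] by auto
  have wr: "w \<noteq> r" using wV by auto
  have sw: "\<sigma> w \<in> V" "infinite (desc (\<sigma> w))" "\<sigma> w \<noteq> r"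
    using aut_V[OF wV(1)] aut_finite_desc[OF wV(1)] wV(2) aut_not_root[OF wV(1)] wr by auto
  have "\<sigma> w \<in> W"
  proof (cases "has_back w")
    case True
    then obtain u where u: "u \<noteq> r" "u \<noteq> par w" "{u, w} \<in> E" "dep u < dep w"
      unfolding has_back_def by blast
    have uV: "u \<in> V" using u edge_V by blast
    have "colour {u, w} = 1" using colour_back u w True by (simp add: back_colour_def)
    then have "colour {\<sigma> u, \<sigma> w} = 1" using aut_colour u by simp
    moreover have "\<sigma> u \<noteq> par (\<sigma> w)"
      unfolding aut_par[OF wV(1) wr] using aut_inj[OF uV par(1)[OF wV(1) wr]] u by simp
    moreover have "dep (\<sigma> u) < dep (\<sigma> w)" using aut_dep uV wV u by simp
    moreover have "\<sigma> u \<noteq> r" using aut_not_root uV u by simp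
    \<comment> \<open>The leaf encoding cannot have produced this colour 1, since \<open>L\<close>
      is empty at vertices with infinite subtrees.\<close>
    ultimately show ?thesis
      using colour_back L_infinite[OF sw(2)] by (auto simp: back_colour_def split: if_splits)
  next
    case nb: False
    show ?thesis
    proof (cases "inner_children w = {}")
      case False
      \<comment> \<open>With \<open>2 \<le> d\<close> the residues 0 and 1 differ, so the sum tells
        whether the mark is present.\<close>
      have d: "2 \<le> d" using W_inner[OF w nb False] .
      have "sum val (C2 w) mod d = 1" using val_sum_infinite[OF wV(2,1) wr False] w nb d by simp
      moreover have "sum val (C2 (\<sigma> w)) = sum val (C2 w)"
        using sum_C2_aut[OF wV(1)] aut_val C2_subset by blast
      moreover have sne: "inner_children (\<sigma> w) \<noteq> {}"
        using aut_inner_children[OF wV(1)] False by simp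
      ultimately have "(if \<sigma> w \<in> W \<and> \<not> has_back (\<sigma> w) then 1 else 0) mod d = 1"
        using val_sum_infinite[OF sw(2,1,3) sne] by metis
      then show ?thesis by (metis mod_0 zero_neq_one)
    next
      case True
      obtain y where y: "y \<in> children w" "infinite (desc y)"
        using infinite_child[OF wV(1,2)] by blast
      note c = childrenD[OF y(1)]
      have "\<not> multi y" using W_single[OF w nb True y(1)] by blast
      then have "colour {w, y} = 3"
        unfolding colour_child[OF y(1)] tree_colour_def using c w wr nb True y by simp
      then have "colour {\<sigma> w, \<sigma> y} = 3" using aut_colour c by simp
      moreover have sy: "\<sigma> y \<in> children (\<sigma> w)" using aut_children[OF wV(1)] y by blast
      moreover have "\<not> multi (\<sigma> y)" using aut_multi[OF y(1)] \<open>\<not> multi y\<close> by simp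
      moreover have "infinite (desc (\<sigma> y))" using aut_finite_desc c y by simp
      \<comment> \<open>Away from the root, the edge to a child that is not \<open>multi\<close> has
        colour 3 only below a vertex of \<open>W\<close>.\<close>
      ultimately show ?thesis
        using colour_child[OF sy] childrenD(3)[OF sy] sw(3) by (simp add: tree_colour_def split: if_splits)
    qed
  qed
  then show ?thesis using W_dep[OF _ w] aut_dep[OF wV(1)] by simp
qed

text \<open>A special vertex in the subtree of \<open>x\<close> is fixed, so it lies below both
  \<open>x\<close> and its image, which have the same depth.\<close>

lemma aut_infinite:
  assumes "x \<in> V" "infinite (desc x)"
  shows "\<sigma> x = x"
proof -
  obtain w where w: "w \<in> W" "w \<in> desc x" using W_everywhere[OF assms] by blast
  then have "\<sigma> w \<in> desc (\<sigma> x)" using aut_desc_iff assms(1) desc_V by blast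
  then show ?thesis
    using desc_disjoint[of w "\<sigma> x" x] aut_W[OF w(1)] w(2) aut_dep[OF assms(1)] by simp
qed

text \<open>Induction from the root downwards, so the parent is fixed. Vertices with infinite
  subtrees are fixed through \<open>W\<close>, a finite touching child has no rival, and the other
  children are separated by class and label.\<close>

lemma aut_trivial: "x \<in> V \<Longrightarrow> \<sigma> x = x"
proof (induction "dep x" arbitrary: x rule: less_induct)
  case less
  show ?case
  proof (cases "x = r \<or> infinite (desc x)")
    case True
    then show ?thesis using fixes_root aut_infinite less.prems by blast
  next
    case False
    let ?v = "par x"
    have x: "x \<in> V" "x \<noteq> r" "finite (desc x)" using False less.prems by auto
    have v: "\<sigma> ?v = ?v" using less.hyps par[OF x(1,2)] by simp
    have cx: "x \<in> children ?v" using child_par x by simp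
    have csx: "\<sigma> x \<in> children ?v" using aut_children[OF par(1)[OF x(1,2)]] v cx by auto
    show ?thesis
    proof (cases "touching x")
      case True
      then show ?thesis
        using touching_unique[OF csx cx] aut_finite_desc aut_touching x by simp
    next
      case False
      then have ix: "x \<in> inner_children ?v" using cx x by (simp add: inner_children_def)
      have isx: "\<sigma> x \<in> inner_children ?v" using aut_inner_child[OF ix] v by simp
      have "colour {?v, \<sigma> x} = colour {?v, x}"
        using aut_colour[OF childrenD(5)[OF cx]] v by simp
      then have "\<sigma> x \<in> C2 ?v \<longleftrightarrow> x \<in> C2 ?v" using C2_colour[OF ix] C2_colour[OF isx] by simp
      then show ?thesis
        using aut_val[OF ix] inj_onD[OF val_inj_C2, of "\<sigma> x" x ?v]
          inj_onD[OF val_inj_C1, of "\<sigma> x" x ?v] ix isx by blast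
    qed
  qed
qed

end

section \<open>Recognising the root by its colours\<close>

context coloured_tree
begin

lemma asymmetric_if_root_fixed:
  assumes "\<And>\<sigma>. colour_aut V E colour \<sigma> \<Longrightarrow> \<sigma> r = r"
  shows "asymmetric_edge_colouring V E colour"
  unfolding asymmetric_edge_colouring_def
proof (intro allI impI ballI)
  fix \<sigma> x assume "graph_automorphism V E \<sigma> \<and> preserves_edge_colours E colour \<sigma>" "x \<in> V"
  then have "colour_aut V E colour \<sigma>" by (simp add: colour_aut_def)
  then interpret coloured_tree_aut V E r X dep rc d val C2 L W \<sigma>
    by unfold_locales (use assms in auto)
  show "\<sigma> x = x" using aut_trivial \<open>x \<in> V\<close> .
qed

text \<open>
  The root has no edge of colour 2; this lists the other vertices that could be confused with it.
\<close>

lemma no_colour_2: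
  assumes x: "x \<in> V" "x \<noteq> r" and no2_all: "\<forall>w. {x, w} \<in> E \<longrightarrow> colour {x, w} \<noteq> 2"
  shows "desc x = {x} \<and> (par x = r \<or> (\<forall>w. {x, w} \<in> E \<longrightarrow> colour {x, w} \<noteq> 3)) \<or>
    infinite (desc x) \<and> (\<forall>w. {x, w} \<in> E \<longrightarrow> colour {x, w} \<noteq> 1) \<and>
    (\<exists>u w. u \<noteq> w \<and> {x, u} \<in> E \<and> {x, w} \<in> E \<and> colour {x, u} = 3 \<and> colour {x, w} = 3)"
proof (cases "children x = {}")
  case True
  then have leaf: "desc x = {x}" using desc_eq[OF x(1)] by simp
  have "colour {x, w} \<noteq> 3" if "par x \<noteq> r" "{x, w} \<in> E" for w
  proof -
    have "w \<notin> desc x" using leaf edge_V[OF that(2)] by auto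
    then have d: "dep w < dep x" using edge_desc that(2) edge_dep by (metis nat_neq_iff)
    have nm: "\<not> multi x" using leaf by (auto simp: multi_def)
    show ?thesis
    proof (cases "w = par x")
      case w: True
      have "colour {w, x} = tree_colour x"
        using colour_child child_par[OF x] w by simp
      then show ?thesis
        using that(1) nm leaf by (simp add: insert_commute tree_colour_def)
    next
      case False
      then have "colour {w, x} = back_colour w x" using colour_back[OF d] by simp
      then show ?thesis using back_colour_range[of w x] by (auto simp: insert_commute)
    qed
  qed
  then show ?thesis using leaf by blast
next
  case False
  note no2 = no2_all[rule_format]
  \<comment> \<open>A child with further edges from \<open>x\<close> into its subtree would force a
    colour 2: on one of those edges or, failing that, on the tree edge.\<close>
  have single: "\<not> multi y" if y: "y \<in> children x" for y
  proof
    assume m: "multi y"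
    then obtain w where w: "w \<in> desc y" "w \<noteq> y" "{x, w} \<in> E"
      using childrenD(3)[OF y] unfolding multi_def by blast
    have "back_colour x w' \<noteq> 2" if "w' \<in> desc y" "w' \<noteq> y" "{x, w'} \<in> E" for w'
      using no2[OF that(3)] colour_back[of x w'] par_desc_child[OF y that(1,2)] by auto
    then have "tree_colour y = 2" using m x(2) childrenD(3)[OF y] by (auto simp: tree_colour_def)
    then show False using no2[OF childrenD(5)[OF y]] colour_child[OF y] by simp
  qed
  have tc: "tree_colour y \<noteq> 2" if y: "y \<in> children x" for y
    using no2[OF childrenD(5)[OF y]] colour_child[OF y] by simp
  \<comment> \<open>Otherwise \<open>C2 x\<close> would contain a child, and its tree edge would
    have colour 2.\<close>
  have no_inner: "inner_children x = {}"
  proof (rule ccontr)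
    assume "inner_children x \<noteq> {}"
    then obtain y where y: "y \<in> C2 x" using C2_nonempty by blast
    then have "y \<in> inner_children x" using C2_subset by blast
    then have "y \<in> children x" "finite (desc y)" using inner_childrenD by auto
    then have "tree_colour y = 2"
      using y single childrenD(3) x(2) by (simp add: tree_colour_def)
    then show False using tc \<open>y \<in> children x\<close> by blast
  qed
  \<comment> \<open>The third kind of mark is the only way left to avoid colour 2 on a tree edge
    below \<open>x\<close>.\<close>
  have child: "infinite (desc y) \<and> x \<in> W \<and> \<not> has_back x \<and> tree_colour y = 3" if y: "y \<in> children x" for y
    using tc[OF y] single[OF y] childrenD(3)[OF y] x(2) no_inner y
    by (auto simp: tree_colour_def inner_children_def split: if_splits)
  obtain y where y: "y \<in> children x" using False by blast
  have xW: "x \<in> W" "\<not> has_back x" using child[OF y] by auto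
  note W = W_infinite[OF xW(1)]
  have pr: "par x \<noteq> r" using par(3)[OF x] W by auto
  have up: "{x, par x} \<in> E" "colour {x, par x} = 3"
  proof -
    show e: "{x, par x} \<in> E" using par(3)[OF x] edge_sym by blast
    have "colour {par x, x} = tree_colour x" using colour_child child_par[OF x] by simp
    then show "colour {x, par x} = 3"
      using tree_colour_infinite[of x] W pr no2[OF e] by (auto simp: insert_commute)
  qed
  have "colour {x, w} = 3" if e: "{x, w} \<in> E" for w
  proof (cases "dep w < dep x")
    case True
    \<comment> \<open>\<open>has_back\<close> disregards edges to the root; these are ruled out by
      \<open>W_infinite\<close>.\<close>
    then have "w = par x"
      using xW(2) W e unfolding has_back_def by (metis insert_commute)
    then show ?thesis using up by simp
  next
    case False
    then have "w \<in> children x" using down_edge[OF e] edge_dep[OF e] single by auto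
    then show ?thesis using colour_child child by simp
  qed
  moreover have "y \<noteq> par x" using childrenD[OF y] par(2)[OF x] by auto
  ultimately show ?thesis using up childrenD(5)[OF y] W by (metis one_eq_numeral_iff semiring_norm(84))
qed

end

section \<open>Labels and special vertices\<close>

text \<open>Along an enumeration of \<open>I\<close>, each witness is chosen with a larger value of
  \<open>f\<close> than the one before.\<close>

lemma ex_spread_out:
  fixes f :: "'b \<Rightarrow> nat"
  assumes "countable I" and ex: "\<And>x N. x \<in> I \<Longrightarrow> \<exists>w. P x w \<and> N \<le> f w"
  shows "\<exists>W. (\<forall>w\<in>W. \<exists>x\<in>I. P x w) \<and> inj_on f W \<and> (\<forall>x\<in>I. \<exists>w\<in>W. P x w)"
proof (cases "I = {}")
  case False
  let ?e = "from_nat_into I"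
  have e: "?e n \<in> I" for n using from_nat_into[OF False] .
  have "\<exists>g. \<forall>n. P (?e n) (g n) \<and> f (g n) < f (g (Suc n))"
  proof (rule dependent_nat_choice)
    show "\<exists>w. P (?e 0) w" using ex[OF e] by blast
    show "\<exists>w'. P (?e (Suc n)) w' \<and> f w < f w'" for w n
      using ex[OF e, of "Suc n" "Suc (f w)"] by (meson Suc_le_lessD)
  qed
  then obtain g where g: "\<And>n. P (?e n) (g n)" "\<And>n. f (g n) < f (g (Suc n))" by blast
  have mono: "strict_mono (\<lambda>n. f (g n))" using g(2) by (simp add: strict_mono_Suc_iff)
  have "inj_on f (range g)" using strict_mono_eq[OF mono] by (auto simp: inj_on_def)
  moreover have "\<exists>w\<in>range g. P x w" if "x \<in> I" for x
    using g(1) from_nat_into_surj[OF assms(1) that] by (metis rangeI)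
  ultimately show ?thesis using g(1) e by (intro exI[of _ "range g"]) blast
qed auto

section \<open>Degree counts, label classes and labels\<close>

locale bounded_tree = normal_tree +
  fixes \<Delta> \<delta> :: nat
  assumes max_deg: "v \<in> V \<Longrightarrow> card {y. {v, y} \<in> E} \<le> \<Delta>"
    and min_deg: "v \<in> V \<Longrightarrow> \<delta> \<le> card {y. {v, y} \<in> E}"
    and ratio: "\<Delta> \<le> 2 * \<delta>" and pos: "1 \<le> \<delta>"
    and countable_V: "countable V"
begin

text \<open>The neighbours of \<open>v\<close> include its parent, its inner children and, for every
  \<open>multi\<close> one among these, a further vertex deeper in that child's subtree; all of
  these are distinct.\<close>

lemma inner_children_count:
  assumes v: "v \<in> V" "v \<noteq> r"
  shows "Suc (card (inner_children v) + card {y \<in> inner_children v. multi y}) \<le> \<Delta>"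
proof -
  let ?F = "inner_children v" and ?M = "{y \<in> inner_children v. multi y}"
  have "\<forall>y\<in>?M. \<exists>w. w \<in> desc y \<and> w \<noteq> y \<and> {v, w} \<in> E"
    using childrenD(3)[OF inner_childrenD(1)] unfolding multi_def by fastforce
  then obtain g where g: "\<And>y. y \<in> ?M \<Longrightarrow> g y \<in> desc y \<and> g y \<noteq> y \<and> {v, g y} \<in> E"
    by (metis (no_types, lifting))
  have c: "y \<in> children v" if "y \<in> ?F" for y using that inner_childrenD by blast
  have dep_c: "dep y = Suc (dep v)" if "y \<in> ?F" for y using childrenD(4)[OF c[OF that]] .
  have dep_g: "Suc (dep v) < dep (g y)" if "y \<in> ?M" for y
    using desc_dep_less g[OF that] dep_c that by (metis (mono_tags, lifting) mem_Collect_eq)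
  have "inj_on g ?M"
  proof (rule inj_onI)
    fix a b assume ab: "a \<in> ?M" "b \<in> ?M" "g a = g b"
    have "g a \<in> desc a" "g a \<in> desc b" using g[OF ab(1)] g[OF ab(2)] ab(3) by auto
    then show "a = b" using desc_disjoint[of "g a" a b] ab dep_c by simp
  qed
  then have card_g: "card (g ` ?M) = card ?M" by (rule card_image)
  have dep_g': "Suc (dep v) < dep u" if "u \<in> g ` ?M" for u using that dep_g by auto
  have "?F \<inter> g ` ?M = {}"
  proof (rule equals0I)
    fix u assume "u \<in> ?F \<inter> g ` ?M"
    then show False using dep_c[of u] dep_g'[of u] by simp
  qed
  moreover have "par v \<notin> ?F \<union> g ` ?M"
  proof
    assume "par v \<in> ?F \<union> g ` ?M"
    then have "dep v < dep (par v)" using dep_c[of "par v"] dep_g'[of "par v"] by (elim UnE) simp_all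
    then show False using par(2)[OF v] by simp
  qed
  ultimately have "card (insert (par v) (?F \<union> g ` ?M)) = Suc (card ?F + card ?M)"
    using finite_inner_children[of v] card_g by (simp add: card_Un_disjoint)
  moreover have "insert (par v) (?F \<union> g ` ?M) \<subseteq> {y. {v, y} \<in> E}"
    using par(3)[OF v] edge_sym g childrenD(5)[OF c] by auto
  ultimately show ?thesis
    using max_deg[OF v(1)] card_mono[OF fin_nb[of v]] by (metis (no_types, lifting) order_trans)
qed

lemma ex_class:
  assumes v: "v \<in> V" "v \<noteq> r"
  shows "\<exists>C\<subseteq>inner_children v. {y \<in> inner_children v. multi y} \<subseteq> C \<and>
    (inner_children v \<noteq> {} \<longrightarrow> C \<noteq> {} \<and> (card C < \<delta> \<or> \<delta> = 1 \<and> card C = 1)) \<and>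
    card (inner_children v - C) \<le> \<delta>"
proof -
  let ?F = "inner_children v" and ?M = "{y \<in> inner_children v. multi y}"
  \<comment> \<open>The class takes \<delta> - 1 children, or one if \<delta> = 1, as far as there
    are that many. By the count below this leaves room for all \<open>multi\<close> children, and at
    most \<delta> children stay outside.\<close>
  define n where "n = min (card ?F) (max 1 (\<delta> - 1))"
  have cnt: "card ?F + card ?M < 2 * \<delta>" using inner_children_count[OF v] ratio by linarith
  have "card ?M \<le> card ?F" by (rule card_mono[OF finite_inner_children]) auto
  then have "card ?M \<le> n" using cnt unfolding n_def by linarith
  then obtain C where C: "?M \<subseteq> C" "C \<subseteq> ?F" "card C = n"
    using exists_subset_between[of ?M n ?F] finite_inner_children[of v] unfolding n_def by auto
  have "card (?F - C) = card ?F - n"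
    using C finite_inner_children[of v] by (metis card_Diff_subset finite_subset)
  then have "card (?F - C) \<le> \<delta>" using cnt pos unfolding n_def by linarith
  moreover have "C \<noteq> {} \<and> (card C < \<delta> \<or> \<delta> = 1 \<and> card C = 1)" if "?F \<noteq> {}"
  proof -
    have "0 < card ?F" using that finite_inner_children[of v] by (simp add: card_gt_0_iff)
    then have "0 < n" "n < \<delta> \<or> \<delta> = 1 \<and> n = 1" using cnt pos unfolding n_def by linarith+
    then show ?thesis using C(3) by auto
  qed
  ultimately show ?thesis using C by blast
qed

text \<open>The default is harmless: the root and non-vertices have no inner children.\<close>

definition class2 :: "'a \<Rightarrow> 'a set" where
  "class2 v = (if v \<in> V \<and> v \<noteq> r then
     (SOME C. C \<subseteq> inner_children v \<and> {y \<in> inner_children v. multi y} \<subseteq> C \<and>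
      (inner_children v \<noteq> {} \<longrightarrow> C \<noteq> {} \<and> (card C < \<delta> \<or> \<delta> = 1 \<and> card C = 1)) \<and>
      card (inner_children v - C) \<le> \<delta>) else {})"

lemma inner_children_parent: "y \<in> inner_children v \<Longrightarrow> v \<in> V \<and> v \<noteq> r"
  using inner_childrenD(1,4) childrenD(6) by blast

lemma class2:
  shows "class2 v \<subseteq> inner_children v"
    and "y \<in> inner_children v \<Longrightarrow> multi y \<Longrightarrow> y \<in> class2 v"
    and "inner_children v \<noteq> {} \<Longrightarrow> class2 v \<noteq> {} \<and> (card (class2 v) < \<delta> \<or> \<delta> = 1 \<and> card (class2 v) = 1)"
    and "card (inner_children v - class2 v) \<le> \<delta>"
proof -
  have *: "class2 v \<subseteq> inner_children v \<and> {y \<in> inner_children v. multi y} \<subseteq> class2 v \<and>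
    (inner_children v \<noteq> {} \<longrightarrow> class2 v \<noteq> {} \<and> (card (class2 v) < \<delta> \<or> \<delta> = 1 \<and> card (class2 v) = 1)) \<and>
    card (inner_children v - class2 v) \<le> \<delta>"
  proof (cases "v \<in> V \<and> v \<noteq> r")
    case True
    then show ?thesis
      using someI_ex[OF ex_class[of v, unfolded Bex_def]] unfolding class2_def by simp
  next
    case False
    then have "inner_children v = {}" using inner_children_parent by blast
    moreover have "class2 v = {}" unfolding class2_def by (rule if_not_P[OF False])
    ultimately show ?thesis by simp
  qed
  then show "class2 v \<subseteq> inner_children v"
    "y \<in> inner_children v \<Longrightarrow> multi y \<Longrightarrow> y \<in> class2 v"
    "inner_children v \<noteq> {} \<Longrightarrow> class2 v \<noteq> {} \<and> (card (class2 v) < \<delta> \<or> \<delta> = 1 \<and> card (class2 v) = 1)"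
    "card (inner_children v - class2 v) \<le> \<delta>" by blast+
qed

text \<open>Inside \<open>class2 v\<close> the labels come from \<open>ex_inj_sum_mod\<close>; on
  the at most \<delta> other inner children any injection into the residues will do.\<close>

lemma ex_values:
  "\<exists>f. inj_on f (class2 v) \<and> inj_on f (inner_children v - class2 v) \<and> f ` inner_children v \<subseteq> {..<\<delta>} \<and>
    (inner_children v \<noteq> {} \<longrightarrow> sum f (class2 v) mod \<delta> = t mod \<delta>)"
proof (cases "inner_children v = {}")
  case True
  then show ?thesis using class2(1)[of v] by auto
next
  case False
  let ?C = "class2 v" and ?F = "inner_children v"
  have fin: "finite ?F" "finite ?C" using finite_inner_children class2(1) finite_subset by blast+
  obtain f where f: "inj_on f ?C" "f ` ?C \<subseteq> {..<\<delta>}" "sum f ?C mod \<delta> = t mod \<delta>"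
    using ex_inj_sum_mod[OF fin(2) conjunct1[OF class2(3)[OF False]] conjunct2[OF class2(3)[OF False]], of t]
    by metis
  obtain g where g: "g ` (?F - ?C) \<subseteq> {..<\<delta>}" "inj_on g (?F - ?C)"
    using card_le_inj[of "?F - ?C" "{..<\<delta>}"] fin class2(4)[of v] by auto
  let ?h = "\<lambda>x. if x \<in> ?C then f x else g x"
  have "inj_on ?h ?C" "sum ?h ?C = sum f ?C" using f(1) by (auto simp: inj_on_def)
  moreover have "inj_on ?h (?F - ?C)" using g(2) by (auto simp: inj_on_def)
  moreover have "?h ` ?F \<subseteq> {..<\<delta>}" using f(2) g(1) by auto
  ultimately show ?thesis using f(3) by (intro exI[of _ ?h]) simp
qed

definition label_choice :: "'a \<Rightarrow> nat \<Rightarrow> 'a \<Rightarrow> nat" where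
  "label_choice v t = (SOME f. inj_on f (class2 v) \<and> inj_on f (inner_children v - class2 v) \<and>
    f ` inner_children v \<subseteq> {..<\<delta>} \<and>
    (inner_children v \<noteq> {} \<longrightarrow> sum f (class2 v) mod \<delta> = t mod \<delta>))"

lemma label_choice:
  shows "inj_on (label_choice v t) (class2 v)" "inj_on (label_choice v t) (inner_children v - class2 v)"
    and "label_choice v t ` inner_children v \<subseteq> {..<\<delta>}"
    and "inner_children v \<noteq> {} \<Longrightarrow> sum (label_choice v t) (class2 v) mod \<delta> = t mod \<delta>"
  using someI_ex[OF ex_values[of v t]] unfolding label_choice_def by blast+

text \<open>Labels are chosen top-down: once \<open>v\<close> has its label, its inner children
  receive labels with the matching sum. Where the subtree is infinite or touching, \<open>t\<close>
  prescribes the sum instead.\<close>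

lemma ex_labels:
  "\<exists>val. (\<forall>v. inj_on val (class2 v) \<and> inj_on val (inner_children v - class2 v) \<and>
     (\<forall>y\<in>inner_children v. val y < \<delta>) \<and>
     (inner_children v \<noteq> {} \<longrightarrow> sum val (class2 v) mod \<delta> =
       (if finite (desc v) \<and> \<not> touching v then val v else t v) mod \<delta>))"
proof -
  define goal where "goal g v = (if finite (desc v) \<and> \<not> touching v then g v else t v)"
    for g :: "'a \<Rightarrow> nat" and v
  \<comment> \<open>Recursion on the depth: \<open>vl n\<close> matters only at vertices of depth
    \<open>n\<close>, and level \<open>Suc n\<close> consults it at the parents. The initial 0 is a
    dummy label for the root.\<close>
  define vl where "vl = rec_nat (\<lambda>x. 0) (\<lambda>n g x. label_choice (par x) (goal g (par x)) x)"
  define val where "val x = vl (dep x) x" for x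
  have val: "val y = label_choice v (goal val v) y" if "y \<in> inner_children v" for v y
  proof -
    note y = childrenD[OF inner_childrenD(1)[OF that]]
    have "val y = label_choice v (goal (vl (dep v)) v) y"
      unfolding val_def y(4) by (simp add: vl_def y(3))
    moreover have "goal (vl (dep v)) v = goal val v" by (simp add: goal_def val_def)
    ultimately show ?thesis by simp
  qed
  show ?thesis
  proof (intro exI[of _ val] allI conjI impI)
    fix v
    let ?f = "label_choice v (goal val v)"
    have C: "val y = ?f y" if "y \<in> class2 v" for y using val class2(1) that by blast
    show "inj_on val (class2 v)" using label_choice(1)[of v "goal val v"] C by (simp add: inj_on_def)
    show "inj_on val (inner_children v - class2 v)"
      using label_choice(2)[of v "goal val v"] val inj_on_cong[of "inner_children v - class2 v" val ?f]
      by auto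
    show "\<forall>y\<in>inner_children v. val y < \<delta>" using label_choice(3)[of v "goal val v"] val by auto
    have "sum val (class2 v) = sum ?f (class2 v)" by (rule sum.cong[OF refl C])
    then show "inner_children v \<noteq> {} \<Longrightarrow> sum val (class2 v) mod \<delta> =
       (if finite (desc v) \<and> \<not> touching v then val v else t v) mod \<delta>"
      using label_choice(4)[of v "goal val v"] by (simp add: goal_def)
  qed
qed

text \<open>Vertices at which one of the three marks can be placed. The last alternative leaves the
  edges to all children at liberty to take colour 3 instead of 2.\<close>

definition free :: "'a \<Rightarrow> bool" where
  "free w \<longleftrightarrow> w \<in> V \<and> infinite (desc w) \<and> 2 \<le> dep w \<and> {r, w} \<notin> E \<and>
    (has_back w \<or> inner_children w \<noteq> {} \<or> (\<forall>y\<in>children w. infinite (desc y) \<and> \<not> multi y))"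

lemma deep_infinite:
  assumes "x \<in> V" "infinite (desc x)"
  shows "\<exists>w\<in>desc x. infinite (desc w) \<and> N \<le> dep w"
proof (induction N)
  case 0
  then show ?case using assms desc_self by blast
next
  case (Suc N)
  then obtain w where w: "w \<in> desc x" "infinite (desc w)" "N \<le> dep w" by blast
  then obtain y where y: "y \<in> children w" "infinite (desc y)"
    using infinite_child desc_V by blast
  then have "y \<in> desc x" using desc_trans childrenD(7) w(1) by blast
  moreover have "Suc N \<le> dep y" using childrenD(4)[OF y(1)] w(3) by simp
  ultimately show ?case using y(2) by blast
qed

text \<open>Take a deep \<open>v\<close> with infinite subtree. If it is not free, a non-tree edge
  leads from \<open>v\<close> to some \<open>w\<close> in an infinite subtree below a child
  \<open>y\<close>. Either \<open>w\<close> has an infinite subtree, and this edge shows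
  \<open>has_back w\<close>, or the path from \<open>y\<close> to \<open>w\<close> passes a vertex
  with an inner child.\<close>

lemma deep_free:
  assumes x: "x \<in> V" "infinite (desc x)"
  shows "\<exists>w. (w \<in> desc x \<and> free w) \<and> N \<le> dep w"
proof -
  obtain N0 where N0: "\<And>w. {r, w} \<in> E \<Longrightarrow> dep w < N0"
    using finite_nat_set_iff_bounded[of "dep ` {w. {r, w} \<in> E}"] fin_nb[of r] by auto
  \<comment> \<open>From depth \<open>K\<close> on, no subtree contains a neighbour of the root, so
    children with finite subtrees are inner.\<close>
  define K where "K = max N (max 2 N0)"
  have K: "N \<le> K" "2 \<le> K" "N0 \<le> K" unfolding K_def by auto
  have not_touching: "\<not> touching y" if "K \<le> dep y" for y
    unfolding touching_def using N0 desc_dep that K(3) by (metis leD order_trans)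
  have freeI: "free w" if "w \<in> V" "infinite (desc w)" "K \<le> dep w"
    "has_back w \<or> inner_children w \<noteq> {} \<or> (\<forall>y\<in>children w. infinite (desc y) \<and> \<not> multi y)" for w
    unfolding free_def using that K N0[of w] by auto
  have inner: "inner_children w \<noteq> {}" if "y \<in> children w" "finite (desc y)" "K \<le> dep w" for y w
    using that not_touching[of y] childrenD(4)[OF that(1)] unfolding inner_children_def by auto
  obtain v where v: "v \<in> desc x" "infinite (desc v)" "K \<le> dep v" using deep_infinite[OF x] by blast
  have vV: "v \<in> V" "v \<noteq> r" using v K desc_V by auto
  show ?thesis
  proof (cases "free v")
    case True
    then show ?thesis using v K(1) by (intro exI[of _ v]) simp
  next
    case False
    then have nf: "\<not> has_back v" "inner_children v = {}"
      "\<not> (\<forall>y\<in>children v. infinite (desc y) \<and> \<not> multi y)"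
      using freeI[OF vV(1) v(2,3)] by blast+
    then obtain y where y: "y \<in> children v" "infinite (desc y)" "multi y"
      using inner[OF _ _ v(3)] by blast
    note c = childrenD[OF y(1)]
    have sub: "desc y \<subseteq> desc x" using child_desc_subset[OF y(1)] desc_trans v(1) by blast
    have deep: "K \<le> dep u" if "u \<in> desc y" for u using desc_dep[OF that] c(4) v(3) by simp
    obtain w where w: "w \<in> desc y" "w \<noteq> y" "{v, w} \<in> E" using y(3) c(3) unfolding multi_def by blast
    have "\<exists>u\<in>desc y. free u"
    proof (cases "infinite (desc w)")
      case True
      have "has_back w"
        unfolding has_back_def using w(3) vV(2) par_desc_child[OF y(1) w(1,2)] by metis
      then show ?thesis using freeI[of w] True deep w(1) desc_V by blast
    next
      case False
      \<comment> \<open>On the tree path from \<open>y\<close> to \<open>w\<close> the subtrees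
        change from infinite to finite; the last infinite one has a child with finite
        subtree.\<close>
      have "infinite (desc w) \<or> (\<exists>u\<in>desc y. infinite (desc u) \<and> (\<exists>t\<in>children u. finite (desc t)))"
        using w(1) c(1)
      proof (induction rule: desc_induct)
        case base
        then show ?case using y(2) by blast
      next
        case (step u t)
        then show ?case by blast
      qed
      then obtain u where u: "u \<in> desc y" "infinite (desc u)" "\<exists>t\<in>children u. finite (desc t)"
        using False by blast
      then show ?thesis using freeI[of u] inner[of _ u] deep[OF u(1)] desc_V by blast
    qed
    then show ?thesis using sub deep K(1) by (meson order_trans subsetD)
  qed
qed

lemma ex_special:
  "\<exists>W. (\<forall>w\<in>W. free w) \<and> inj_on dep W \<and> (\<forall>x\<in>V. infinite (desc x) \<longrightarrow> W \<inter> desc x \<noteq> {})"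
proof -
  have "countable {x \<in> V. infinite (desc x)}" by (rule countable_subset[OF _ countable_V]) auto
  then obtain W where W: "\<forall>w\<in>W. \<exists>x\<in>{x \<in> V. infinite (desc x)}. w \<in> desc x \<and> free w" "inj_on dep W"
    "\<forall>x\<in>{x \<in> V. infinite (desc x)}. \<exists>w\<in>W. w \<in> desc x \<and> free w"
    using ex_spread_out[of "{x \<in> V. infinite (desc x)}" "\<lambda>x w. w \<in> desc x \<and> free w" dep] deep_free
    by auto
  then show ?thesis by (intro exI[of _ W]) blast
qed

text \<open>Without the parent at least \<delta> - 1 neighbours remain, enough to encode every label
  below \<delta>.\<close>

lemma ex_back_set:
  assumes "y \<in> inner_children v" "desc y = {y}" "k < \<delta>"
  shows "\<exists>L\<subseteq>{u. {u, y} \<in> E \<and> u \<noteq> par y}. card L = k"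
proof -
  note c = childrenD[OF inner_childrenD(1)[OF assms(1)]]
  have "{u. {u, y} \<in> E \<and> u \<noteq> par y} = {u. {y, u} \<in> E} - {par y}" by (auto simp: insert_commute)
  moreover have "par y \<in> {u. {y, u} \<in> E}" using par(3)[OF c(1,2)] edge_sym by blast
  ultimately have "card {u. {u, y} \<in> E \<and> u \<noteq> par y} = card {u. {y, u} \<in> E} - 1"
    by simp
  then have "k \<le> card {u. {u, y} \<in> E \<and> u \<noteq> par y}" using min_deg[OF c(1)] assms(3) by simp
  from obtain_subset_with_card_n[OF this] show ?thesis by blast
qed

text \<open>Leaves two obligations for a choice of root: admissible colours at the root and
  uniqueness of finite touching siblings.\<close>

lemma ex_coloured_tree:
  assumes rc: "\<And>y. rc y \<in> {1, 3}" "\<And>y. y \<in> children r \<Longrightarrow> multi y \<Longrightarrow> rc y = 3"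
    and unique: "\<And>v y y'. y \<in> children v \<Longrightarrow> y' \<in> children v \<Longrightarrow> finite (desc y) \<Longrightarrow> finite (desc y') \<Longrightarrow>
      touching y \<Longrightarrow> touching y' \<Longrightarrow> y = y'"
  shows "\<exists>val C2 L W. coloured_tree V E r X dep rc \<delta> val C2 L W"
proof -
  obtain W where W: "\<And>w. w \<in> W \<Longrightarrow> free w" "inj_on dep W"
    "\<And>x. x \<in> V \<Longrightarrow> infinite (desc x) \<Longrightarrow> W \<inter> desc x \<noteq> {}" using ex_special by metis
  obtain val where val: "\<And>v. inj_on val (class2 v)" "\<And>v. inj_on val (inner_children v - class2 v)"
    "\<And>v y. y \<in> inner_children v \<Longrightarrow> val y < \<delta>"
    "\<And>v. inner_children v \<noteq> {} \<Longrightarrow> sum val (class2 v) mod \<delta> =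
       (if finite (desc v) \<and> \<not> touching v then val v else (if v \<in> W \<and> \<not> has_back v then 1 else 0)) mod \<delta>"
    using ex_labels[of "\<lambda>v. if v \<in> W \<and> \<not> has_back v then 1 else 0"] by metis
  define L where "L y = (if (\<exists>v. y \<in> inner_children v) \<and> desc y = {y} then
    (SOME S. S \<subseteq> {u. {u, y} \<in> E \<and> u \<noteq> par y} \<and> card S = val y) else {})" for y
  have L: "L y \<subseteq> {u. {u, y} \<in> E \<and> u \<noteq> par y} \<and> card (L y) = val y"
    if "y \<in> inner_children v" "desc y = {y}" for y v
  proof -
    have "\<exists>S. S \<subseteq> {u. {u, y} \<in> E \<and> u \<noteq> par y} \<and> card S = val y"
      using ex_back_set[OF that val(3)[OF that(1)]] by blast
    from someI_ex[OF this] show ?thesis using that unfolding L_def by auto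
  qed
  have "coloured_tree V E r X dep rc \<delta> val class2 L W"
  proof unfold_locales
    fix v u assume v: "v \<in> inner_children u" "inner_children v \<noteq> {}"
    then show "sum val (class2 v) mod \<delta> = val v"
      using val(4)[OF v(2)] val(3)[OF v(1)] inner_childrenD(2,3)[OF v(1)] by simp
  next
    \<comment> \<open>Such a \<open>w\<close> has a parent, a child with finite subtree and a child
      with infinite subtree, hence degree at least 3; this forces \<delta> to be at least 2.\<close>
    fix w assume w: "w \<in> W" "\<not> has_back w" "inner_children w \<noteq> {}"
    have f: "w \<in> V" "infinite (desc w)" "w \<noteq> r" using W(1)[OF w(1)] unfolding free_def by auto
    obtain y y' where y: "y \<in> inner_children w" and y': "y' \<in> children w" "infinite (desc y')"
      using w(3) infinite_child[OF f(1,2)] by blast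
    note c = childrenD[OF inner_childrenD(1)[OF y]] and c' = childrenD[OF y'(1)]
    have "y \<noteq> y'" "par w \<noteq> y" "par w \<noteq> y'"
      using y'(2) inner_childrenD(2)[OF y] c(4) c'(4) par(2)[OF f(1,3)] by auto
    then have "card {par w, y, y'} = 3" by simp
    moreover have "{par w, y, y'} \<subseteq> {u. {w, u} \<in> E}"
      using c(5) c'(5) par(3)[OF f(1,3)] edge_sym by auto
    ultimately have "3 \<le> card {u. {w, u} \<in> E}" using card_mono[OF fin_nb[of w]] by metis
    then have "3 \<le> \<Delta>" using max_deg[OF f(1)] by simp
    then show "2 \<le> \<delta>" using ratio by simp
  next
    show "rc y \<in> {1, 3}" for y by (rule rc(1))
    show "rc y = 3" if "y \<in> children r" "multi y" for y by (rule rc(2)[OF that])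
    show "class2 v \<subseteq> inner_children v" for v by (rule class2(1))
    show "class2 v \<noteq> {}" if "inner_children v \<noteq> {}" for v using class2(3)[OF that] by blast
    show "y \<in> class2 v" if "y \<in> inner_children v" "multi y" for y v by (rule class2(2)[OF that])
    show "inj_on val (class2 v)" "inj_on val (inner_children v - class2 v)" for v by (rule val)+
    show "val y < \<delta>" if "y \<in> inner_children v" for y v by (rule val(3)[OF that])
    show "sum val (class2 v) mod \<delta> = (if v \<in> W \<and> \<not> has_back v then 1 else 0) mod \<delta>"
      if "infinite (desc v)" "inner_children v \<noteq> {}" for v using val(4)[OF that(2)] that(1) by simp
    show "L y \<subseteq> {u. {u, y} \<in> E \<and> u \<noteq> par y} \<and> card (L y) = val y"
      if "y \<in> inner_children v" "desc y = {y}" for y v by (rule L[OF that])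
    show "L y = {}" if "infinite (desc y)" for y
      unfolding L_def using that by (metis finite.emptyI finite_insert)
    show "w \<in> V \<and> infinite (desc w) \<and> 2 \<le> dep w \<and> {r, w} \<notin> E" if "w \<in> W" for w
      using W(1)[OF that] unfolding free_def by blast
    show "infinite (desc y) \<and> \<not> multi y"
      if "w \<in> W" "\<not> has_back w" "inner_children w = {}" "y \<in> children w" for w y
      using W(1)[OF that(1)] that(2-) unfolding free_def by blast
    show "w = w'" if "w \<in> W" "w' \<in> W" "dep w = dep w'" for w w' using inj_onD[OF W(2) that(3,1,2)] .
    show "W \<inter> desc x \<noteq> {}" if "x \<in> V" "infinite (desc x)" for x by (rule W(3)[OF that])
    show "y = y'" if "y \<in> children v" "y' \<in> children v" "finite (desc y)" "finite (desc y')"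
      "touching y" "touching y'" for v y y' by (rule unique[OF that])
  qed
  then show ?thesis by blast
qed

end

section \<open>The two kinds of roots\<close>

context bounded_tree
begin

lemma root_image:
  assumes \<sigma>: "colour_aut V E \<phi> \<sigma>" and e: "{\<sigma> r, u} \<in> E"
  shows "\<exists>w. {r, w} \<in> E \<and> u = \<sigma> w \<and> \<phi> {\<sigma> r, u} = \<phi> {r, w}"
proof -
  obtain w where w: "w \<in> V" "\<sigma> w = u" using colour_aut_surj[OF \<sigma>] edge_V[OF e] by blast
  then have "{r, w} \<in> E" using colour_aut_edge[OF \<sigma> root_V w(1)] e by simp
  then show ?thesis using colour_aut_colour[OF \<sigma>] w by metis
qed

text \<open>The root has no edge of colour 2 but has one of colour 1. By \<open>no_colour_2\<close>,
  any other vertex without colour 2, its subtree being infinite, has no colour 1 either.\<close>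

lemma asymmetric_leafless:
  assumes inf: "\<And>x. x \<in> V \<Longrightarrow> infinite (desc x)"
  shows "\<exists>\<phi>. (\<forall>e. \<phi> e \<in> {1, 2, 3 :: nat}) \<and> asymmetric_edge_colouring V E \<phi>"
proof -
  define rc where "rc y = (if multi y then 3 else 1 :: nat)" for y
  have "\<exists>val C2 L W. coloured_tree V E r X dep rc \<delta> val C2 L W"
    by (rule ex_coloured_tree) (use inf childrenD(1) in \<open>auto simp: rc_def\<close>)
  then obtain val C2 L W where "coloured_tree V E r X dep rc \<delta> val C2 L W" by blast
  then interpret coloured_tree V E r X dep rc \<delta> val C2 L W .
  have root_colour: "colour {r, w} \<noteq> 2" if "{r, w} \<in> E" for w
  proof (cases "w \<in> children r")
    case True
    then show ?thesis
      using colour_child[OF True] childrenD(3)[OF True] by (simp add: tree_colour_def rc_def)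
  next
    case False
    have w: "w \<in> V" "w \<noteq> r" using edge_V[OF that] by auto
    then have "r \<noteq> par w" "dep r < dep w" using False child_par par(2) by auto
    then show ?thesis using colour_back back_colour_root by simp
  qed
  obtain w1 where w1: "{r, w1} \<in> E" "colour {r, w1} = 1"
  proof -
    obtain y where y: "y \<in> children r" using infinite_child[OF root_V inf[OF root_V]] by blast
    note c = childrenD[OF y]
    show ?thesis
    proof (cases "multi y")
      case True
      then obtain w where w: "w \<in> desc y" "w \<noteq> y" "{r, w} \<in> E" using c(3) unfolding multi_def by blast
      then have "colour {r, w} = 1"
        using colour_back[of r w] back_colour_root par_desc_child[OF y w(1,2)] by auto
      then show ?thesis using that w(3) by blast
    next
      case False
      then have "colour {r, y} = 1" using colour_child[OF y] c(3) by (simp add: tree_colour_def rc_def)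
      then show ?thesis using that c(5) by blast
    qed
  qed
  have "\<sigma> r = r" if \<sigma>: "colour_aut V E colour \<sigma>" for \<sigma>
  proof (rule ccontr)
    assume ne: "\<sigma> r \<noteq> r"
    have V: "\<sigma> r \<in> V" using colour_aut_V[OF \<sigma> root_V] .
    have no2: "\<forall>u. {\<sigma> r, u} \<in> E \<longrightarrow> colour {\<sigma> r, u} \<noteq> 2"
      using root_image[OF \<sigma>] root_colour by metis
    have "{\<sigma> r, \<sigma> w1} \<in> E" "colour {\<sigma> r, \<sigma> w1} = 1"
      using colour_aut_edge[OF \<sigma> root_V] colour_aut_colour[OF \<sigma> w1(1)] w1 edge_V by auto
    moreover have "desc (\<sigma> r) \<noteq> {\<sigma> r}" using inf[OF V] by (metis finite.emptyI finite_insert)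
    ultimately show False using no_colour_2[OF V ne no2] by blast
  qed
  then show ?thesis using asymmetric_if_root_fixed colour_range by blast
qed

text \<open>A touching vertex is determined by its depth, as it lies on \<open>c\<close>; so the
  root has the single child \<open>c 1\<close>. That edge has colour 3 and the other edges at the
  root have colour 1. A rival of the root would have exactly one edge of colour 3, hence be
  \<open>c 1\<close> as a leaf, which leaves only two vertices.\<close>

lemma asymmetric_root_neighbours_on_path:
  assumes c: "\<And>i j. i \<le> j \<Longrightarrow> j \<le> z \<Longrightarrow> X i (c j) = c i" "\<And>j. j \<le> z \<Longrightarrow> dep (c j) = j"
    and nb: "\<And>w. {r, w} \<in> E \<Longrightarrow> w \<in> c ` {..z}"
    and notK2: "\<And>y. V \<noteq> {r, y}"
  shows "\<exists>\<phi>. (\<forall>e. \<phi> e \<in> {1, 2, 3 :: nat}) \<and> asymmetric_edge_colouring V E \<phi>"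
proof -
  have touch: "y = c (dep y)" if t: "touching y" for y
  proof -
    obtain j where j: "c j \<in> desc y" "j \<le> z" using t nb unfolding touching_def by blast
    then have "dep y \<le> j" using desc_dep c(2) by fastforce
    then show ?thesis using desc_X[OF j(1)] c(1) j(2) by simp
  qed
  define rc where "rc y = (3 :: nat)" for y :: 'a
  have "\<exists>val C2 L W. coloured_tree V E r X dep rc \<delta> val C2 L W"
  proof (rule ex_coloured_tree)
    fix v y y' assume "y \<in> children v" "y' \<in> children v" "touching y" "touching y'"
    then show "y = y'" using touch childrenD(4) by metis
  qed (auto simp: rc_def)
  then obtain val C2 L W where "coloured_tree V E r X dep rc \<delta> val C2 L W" by blast
  then interpret coloured_tree V E r X dep rc \<delta> val C2 L W .
  have child: "y = c 1" if "y \<in> children r" for y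
    using touch[OF touching_child_root[OF that]] childrenD(4)[OF that] by simp
  have "V \<noteq> {r}" using notK2[of r] by simp
  then obtain y0 where "y0 \<in> V" "y0 \<noteq> r" using root_V by blast
  then obtain y1 where "y1 \<in> children r" using desc_child[of y0 r] X_0 root_V by (auto simp: desc_def)
  then have c1: "c 1 \<in> children r" using child by simp
  have root_colour: "colour {r, w} = (if w = c 1 then 3 else 1)" if "{r, w} \<in> E" for w
  proof (cases "w = c 1")
    case True
    then show ?thesis
      using colour_child[OF c1] childrenD(3)[OF c1] by (simp add: tree_colour_def rc_def)
  next
    case False
    have w: "w \<in> V" "w \<noteq> r" using edge_V[OF that] by auto
    then have "r \<noteq> par w" "dep r < dep w" using False child_par[OF w] child par(2)[OF w] by auto
    then show ?thesis using colour_back back_colour_root False by simp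
  qed
  have "\<sigma> r = r" if \<sigma>: "colour_aut V E colour \<sigma>" for \<sigma>
  proof (rule ccontr)
    assume ne: "\<sigma> r \<noteq> r"
    have V: "\<sigma> r \<in> V" using colour_aut_V[OF \<sigma> root_V] .
    have img: "\<exists>w. {r, w} \<in> E \<and> u = \<sigma> w \<and> colour {\<sigma> r, u} = (if w = c 1 then 3 else 1)"
      if "{\<sigma> r, u} \<in> E" for u
      using root_image[OF \<sigma> that] root_colour by metis
    have no2: "\<forall>u. {\<sigma> r, u} \<in> E \<longrightarrow> colour {\<sigma> r, u} \<noteq> 2"
      using img by (fastforce split: if_splits)
    have three: "{\<sigma> r, \<sigma> (c 1)} \<in> E" "colour {\<sigma> r, \<sigma> (c 1)} = 3"
      using colour_aut_edge[OF \<sigma> root_V] colour_aut_colour[OF \<sigma>] childrenD(1,5)[OF c1] root_colour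
      by auto
    have only: "u = \<sigma> (c 1)" if "{\<sigma> r, u} \<in> E" "colour {\<sigma> r, u} = 3" for u
      using img[OF that(1)] that(2) by (auto split: if_splits)
    have "desc (\<sigma> r) = {\<sigma> r} \<and> par (\<sigma> r) = r"
    proof -
      have "\<not> (\<forall>w. {\<sigma> r, w} \<in> E \<longrightarrow> colour {\<sigma> r, w} \<noteq> 3)" using three by blast
      moreover have "\<not> (\<exists>u w. u \<noteq> w \<and> {\<sigma> r, u} \<in> E \<and> {\<sigma> r, w} \<in> E \<and>
          colour {\<sigma> r, u} = 3 \<and> colour {\<sigma> r, w} = 3)" using only by blast
      ultimately show ?thesis using no_colour_2[OF V ne no2] by argo
    qed
    then have "\<sigma> r = c 1" "desc (\<sigma> r) = {\<sigma> r}" using child[of "\<sigma> r"] child_par[OF V ne] by simp_all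
    then have "desc (c 1) = {c 1}" by metis
    moreover have "V = desc r" using X_0 by (auto simp: desc_def)
    moreover have "children r = {c 1}" using child c1 by blast
    ultimately have "V = {r, c 1}" using desc_eq[OF root_V] by simp
    then show False using notK2 by blast
  qed
  then show ?thesis using asymmetric_if_root_fixed colour_range by blast
qed

end

section \<open>Leaves, countability and the choice of the root\<close>

lemma (in normal_tree) finite_desc_leaf:
  assumes "x \<in> V" "finite (desc x)"
  shows "\<exists>y\<in>V. desc y = {y}"
  using assms
proof (induction "card (desc x)" arbitrary: x rule: less_induct)
  case less
  show ?case
  proof (cases "children x = {}")
    case True
    then show ?thesis using desc_eq[OF less.prems(1)] less.prems(1) by auto
  next
    case False
    then obtain y where y: "y \<in> children x" by blast
    note c = childrenD[OF y]
    have "x \<notin> desc y" using c desc_dep[of x y] by auto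
    then have "desc y \<subset> desc x" using child_desc_subset[OF y] desc_self[OF c(6)] by blast
    then show ?thesis
      using less.hyps[OF psubset_card_mono[OF less.prems(2)] c(1)] less.prems(2) finite_subset by blast
  qed
qed

text \<open>For each \<open>n\<close> only finitely many vertices end a walk of length
  \<open>n\<close> from \<open>r\<close>, and every vertex ends some such walk.\<close>

lemma countable_if_locally_finite:
  assumes r: "r \<in> V" "\<forall>y\<in>V. (r, y) \<in> {(u, v). {u, v} \<in> E}\<^sup>*"
    and fin: "\<And>x. finite {y. {x, y} \<in> E}"
  shows "countable V"
proof -
  let ?R = "{(u, v). {u, v} \<in> E}"
  have "finite {y. (r, y) \<in> ?R ^^ n}" for n
  proof (induction n)
    case (Suc n)
    have "{y. (r, y) \<in> ?R ^^ Suc n} = (\<Union>x\<in>{y. (r, y) \<in> ?R ^^ n}. {y. {x, y} \<in> E})" by auto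
    then show ?case using Suc fin by simp
  qed simp
  then have "countable (\<Union>n. {y. (r, y) \<in> ?R ^^ n})" by (simp add: countable_finite)
  moreover have "V \<subseteq> (\<Union>n. {y. (r, y) \<in> ?R ^^ n})" using r(2) by (auto simp: rtrancl_power)
  ultimately show ?thesis by (rule countable_subset[rotated])
qed

theorem theorem1:
  fixes V :: "'a set" and E :: "'a set set" and \<Delta> \<delta> :: nat
  assumes "simple_graph V E"
    and "connected_graph V E"
    and "max_degree V E = enat \<Delta>"
    and "min_degree V E = enat \<delta>"
    and "real \<delta> \<ge> real \<Delta> / 2"
    and "\<not> is_complete_graph 2 V E"
  shows "\<exists>\<phi> :: 'a set \<Rightarrow> nat. \<phi> \<in> E \<rightarrow> {1, 2, 3} \<and> asymmetric_edge_colouring V E \<phi>"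
proof -
  have EV: "x \<in> V \<and> y \<in> V \<and> x \<noteq> y" if "{x, y} \<in> E" for x y
  proof -
    have "{x, y} \<subseteq> V" "card {x, y} = 2" using that assms(1) by (auto simp: simple_graph_def nsets_def)
    then show ?thesis by (auto simp: card_insert_if split: if_splits)
  qed
  have V_ne: "V \<noteq> {}" and conn: "\<And>x y. x \<in> V \<Longrightarrow> y \<in> V \<Longrightarrow> (x, y) \<in> {(u, v). {u, v} \<in> E}\<^sup>*"
    using assms(2) by (auto simp: connected_graph_def)
  obtain v0 where v0: "v0 \<in> V" using V_ne by blast
  have deg: "finite {y. {v, y} \<in> E}" "card {y. {v, y} \<in> E} \<le> \<Delta>" "\<delta> \<le> card {y. {v, y} \<in> E}"
    if "v \<in> V" for v
  proof -
    have "degree E v \<le> enat \<Delta>" using assms(3) that unfolding max_degree_def by (metis SUP_upper)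
    moreover have "enat \<delta> \<le> degree E v" using assms(4) that unfolding min_degree_def by (metis INF_lower)
    ultimately show "finite {y. {v, y} \<in> E}" "card {y. {v, y} \<in> E} \<le> \<Delta>" "\<delta> \<le> card {y. {v, y} \<in> E}"
      by (auto simp: degree_def neighbours_def split: if_splits)
  qed
  have fin: "finite {y. {x, y} \<in> E}" for x
  proof (cases "x \<in> V")
    case False
    then have "{y. {x, y} \<in> E} = {}" using EV by blast
    then show ?thesis by simp
  qed (rule deg)
  show ?thesis
  proof (cases "V = {v0}")
    case True
    \<comment> \<open>A single vertex is set apart because \<delta> = 0 there, while
      \<open>bounded_tree\<close> assumes \<delta> positive.\<close>
    have "graph_automorphism V E \<sigma> \<Longrightarrow> \<sigma> v0 = v0" for \<sigma>
      using True by (auto simp: graph_automorphism_def bij_betw_def)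
    then show ?thesis using True
      by (intro exI[of _ "\<lambda>_. 1"]) (auto simp: asymmetric_edge_colouring_def)
  next
    case False
    then obtain v1 where v1: "v1 \<in> V" "v1 \<noteq> v0" using v0 by blast
    obtain w where "{v0, w} \<in> E" using conn[OF v0 v1(1)] v1(2) by (auto elim: converse_rtranclE)
    then have "card {y. {v0, y} \<in> E} \<noteq> 0" using deg(1)[OF v0] by auto
    then have "1 \<le> \<Delta>" using deg(2)[OF v0] by simp
    then have pos: "1 \<le> \<delta>" and ratio: "\<Delta> \<le> 2 * \<delta>" using assms(5) by linarith+
    have cV: "countable V" using countable_if_locally_finite[OF v0 _ fin] conn[OF v0] by blast
    define idx where "idx = to_nat_on V"
    have idx: "inj_on idx V" unfolding idx_def using inj_on_to_nat_on[OF cV] .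
    have comp: "component E V t = V" if t: "t \<in> V" for t
    proof
      show "component E V t \<subseteq> V" by (rule component_subset[OF t])
      have "{(u, v). {u, v} \<in> E} = induced_rel E V" using EV by (auto simp: induced_rel_def)
      then show "V \<subseteq> component E V t" using conn[OF t] by (auto simp: component_def)
    qed
    have bounded: "bounded_tree V E r X dep \<Delta> \<delta>" if "normal_tree V E r X dep" for r X dep
      unfolding bounded_tree_def bounded_tree_axioms_def using that deg ratio pos cV by blast
    have finish: ?thesis if "\<exists>\<phi>. (\<forall>e. \<phi> e \<in> {1, 2, 3 :: nat}) \<and> asymmetric_edge_colouring V E \<phi>"
      using that by blast
    \<comment> \<open>A first search from an arbitrary root, with the prescribed path reduced to
      that root.\<close>
    interpret S0: tree_search V E idx "\<lambda>_. v0" 0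
      by unfold_locales (use EV comp idx fin v0 in auto)
    interpret T0: bounded_tree V E v0 S0.X S0.depth \<Delta> \<delta>
      by (rule bounded[OF S0.normal_tree])
    show ?thesis
    proof (cases "\<forall>x\<in>V. infinite (T0.desc x)")
      case True
      then show ?thesis by (intro finish T0.asymmetric_leafless) blast
    next
      case False
      then obtain y where y: "y \<in> V" "T0.desc y = {y}" using T0.finite_desc_leaf by blast
      define z where "z = S0.depth y"
      \<comment> \<open>The tree path from the leaf \<open>y\<close> back up to \<open>v0\<close>.
        By normality it contains all neighbours of \<open>y\<close>, so the second search, rooted at
        \<open>y\<close>, is made to start along it.\<close>
      define c where "c i = S0.X (z - i) y" for i
      have dep_c: "S0.depth (c i) = z - i" for i
        unfolding c_def z_def by (rule T0.dep_X[OF y(1)]) simp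
      interpret S: tree_search V E idx c z
      proof unfold_locales
        show "c i \<in> V" if "i \<le> z" for i unfolding c_def z_def by (rule T0.X_V[OF y(1)]) simp
        show "inj_on c {..z}"
        proof (rule inj_onI)
          fix i j assume "i \<in> {..z}" "j \<in> {..z}" "c i = c j"
          then show "i = j" using dep_c[of i] dep_c[of j] by simp
        qed
        show "{c i, c (Suc i)} \<in> E" if i: "i < z" for i
        proof -
          have "Suc (z - Suc i) = z - i" using i by simp
          then show ?thesis
            using T0.X_edge[OF y(1), of "z - Suc i"] i unfolding c_def z_def by (simp add: insert_commute)
        qed
      qed (use EV comp idx fin in auto)
      have c0: "c 0 = y" unfolding c_def z_def using T0.X_dep[OF y(1)] by simp
      interpret T: bounded_tree V E "c 0" S.X S.depth \<Delta> \<delta>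
        by (rule bounded[OF S.normal_tree])
      have "w \<in> c ` {..z}" if e: "{c 0, w} \<in> E" for w
      proof -
        have e': "{w, y} \<in> E" "{y, w} \<in> E" using e c0 by (auto simp: insert_commute)
        have "w \<notin> T0.desc y" using y(2) EV[OF e'(1)] by auto
        then have "S0.depth w < z"
          using T0.edge_desc[OF e'(2)] T0.edge_dep[OF e'(2)] unfolding z_def by (metis nat_neq_iff)
        then have "w = c (z - S0.depth w)"
          using T0.edge_comparable[OF e'(1)] unfolding c_def z_def by simp
        then show ?thesis by auto
      qed
      moreover have "V \<noteq> {c 0, u}" for u
      proof
        assume V: "V = {c 0, u}"
        then have "finite V" by simp
        have "u \<noteq> c 0" using V False v0 v1 by auto
        have "card V = 2" using V \<open>u \<noteq> c 0\<close> by auto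
        moreover have "E = nsets V 2"
        proof
          show "E \<subseteq> nsets V 2" using assms(1) by (simp add: simple_graph_def)
          have "(c 0, u) \<in> {(u, v). {u, v} \<in> E}\<^sup>*" using conn V by blast
          then obtain w where "{c 0, w} \<in> E" using \<open>u \<noteq> c 0\<close> by (auto elim: converse_rtranclE)
          then have "V \<in> E" using EV[of "c 0" w] V by auto
          moreover have "S = V" if "S \<in> nsets V 2" for S
            using that \<open>finite V\<close> \<open>card V = 2\<close> by (simp add: nsets_def card_subset_eq)
          ultimately show "nsets V 2 \<subseteq> E" by blast
        qed
        ultimately show False using assms(6) \<open>finite V\<close> by (simp add: is_complete_graph_def)
      qed
      ultimately show ?thesis
        using S.path_start S.depth_path
        by (intro finish T.asymmetric_root_neighbours_on_path[of z c]) blast+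
    qed
  qed
qed

end
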